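(* The natural functor $\operatorname{Qcoh}(T)=\operatorname{Ind}(\operatorname{Vect}(T))\to HM(T)$ extending the embedding $\operatorname{Vect}(T)\hookrightarrow HM(T)$ is fully faithful.
   Context: Fix an irrational real number $\theta$ and $\tau\in\mathbb C$ with $\operatorname{Im}\tau<0$. $A_\theta$ is the algebra of series $\sum_{(m,n)\in\mathbb Z^2}a_{m,n}U_1^mU_2^n$ with $U_1U_2=\exp(2\pi i\theta)U_2U_1$ and $(a_{m,n})$ complex numbers rapidly decreasing as $m^2+n^2\to\infty$. The derivation $\delta_\tau:A_\theta\to A_\theta$ is $\delta_\tau(\sum a_{m,n}U_1^mU_2^n)=2\pi i\sum a_{m,n}(m\tau+n)U_1^mU_2^n$. Modules are right modules. A holomorphic module on $T=T_{\theta,\tau}$ is a right $A_\theta$-module $M$ with a ($\mathbb C$-linear) operator $\overline\nabla:M\to M$ such that $\overline\nabla(sa)=\overline\nabla(s)a+s\,\delta_\tau(a)$ for $s\in M$, $a\in A_\theta$; morphisms are $A_\theta$-linear maps commuting with the operators $\overline\nabla$. The category of holomorphic modules is denoted $HM(T)$; it is abelian and has all small filtering inductive limits (computed on underlying modules). A holomorphic vector bundle is a holomorphic module whose underlying $A_\theta$-module is finitely generated projective; $\operatorname{Vect}(T)\subset HM(T)$ is the full subcategory of these (known to be abelian). $\operatorname{Ind}$ denotes the category of ind-objects (formal small filtering inductive limits), and by definition $\operatorname{Qcoh}(T)=\operatorname{Ind}(\operatorname{Vect}(T))$. The natural functor $\operatorname{Qcoh}(T)\to HM(T)$ is the unique (up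 to isomorphism) extension of the embedding $\operatorname{Vect}(T)\hookrightarrow HM(T)$ commuting with small filtering inductive limits: it sends the ind-object given by an inductive system $(P_i)$ to $\varinjlim P_i$ taken in $HM(T)$. *)

theory Defs
  imports "HOL-Analysis.Analysis" "HOL-Algebra.Module" "HOL-Library.FuncSet"
begin

section \<open>Categories and functors\<close>

text \<open>A category is given by indexed hom-sets, which need not be disjoint; composition and the
  action of a functor on morphisms therefore take the source and target objects as arguments.
  In \<open>Cmp C X Y Z g f\<close> the morphism \<open>f : X \<rightarrow> Y\<close> is applied first.
  Smallness is expressed by types: the objects and morphisms of a category form sets over the
  type parameters.\<close>

record ('o, 'a) cat =
  Obj :: "'o set"
  Hom :: "'o \<Rightarrow> 'o \<Rightarrow> 'a set"
  Idn :: "'o \<Rightarrow> 'a"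
  Cmp :: "'o \<Rightarrow> 'o \<Rightarrow> 'o \<Rightarrow> 'a \<Rightarrow> 'a \<Rightarrow> 'a"

definition category :: "('o, 'a) cat \<Rightarrow> bool" where
  "category C \<longleftrightarrow>
     (\<forall>X\<in>Obj C. Idn C X \<in> Hom C X X) \<and>
     (\<forall>X\<in>Obj C. \<forall>Y\<in>Obj C. \<forall>Z\<in>Obj C. \<forall>f\<in>Hom C X Y. \<forall>g\<in>Hom C Y Z. Cmp C X Y Z g f \<in> Hom C X Z) \<and>
     (\<forall>X\<in>Obj C. \<forall>Y\<in>Obj C. \<forall>f\<in>Hom C X Y.
        Cmp C X X Y f (Idn C X) = f \<and> Cmp C X Y Y (Idn C Y) f = f) \<and>
     (\<forall>W\<in>Obj C. \<forall>X\<in>Obj C. \<forall>Y\<in>Obj C. \<forall>Z\<in>Obj C.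
        \<forall>f\<in>Hom C W X. \<forall>g\<in>Hom C X Y. \<forall>h\<in>Hom C Y Z.
        Cmp C W Y Z h (Cmp C W X Y g f) = Cmp C W X Z (Cmp C X Y Z h g) f)"

definition full_subcategory :: "('o, 'a) cat \<Rightarrow> 'o set \<Rightarrow> ('o, 'a) cat" where
  "full_subcategory C S = C\<lparr>Obj := Obj C \<inter> S\<rparr>"

definition filtered_category :: "('o, 'a) cat \<Rightarrow> bool" where
  "filtered_category C \<longleftrightarrow> category C \<and> Obj C \<noteq> {} \<and>
     (\<forall>i\<in>Obj C. \<forall>j\<in>Obj C. \<exists>k\<in>Obj C. Hom C i k \<noteq> {} \<and> Hom C j k \<noteq> {}) \<and>
     (\<forall>i\<in>Obj C. \<forall>j\<in>Obj C. \<forall>u\<in>Hom C i j. \<forall>v\<in>Hom C i j.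
        \<exists>k\<in>Obj C. \<exists>w\<in>Hom C j k. Cmp C i j k w u = Cmp C i j k w v)"

definition is_functor ::
  "('o, 'a) cat \<Rightarrow> ('p, 'b) cat \<Rightarrow> ('o \<Rightarrow> 'p) \<Rightarrow> ('o \<Rightarrow> 'o \<Rightarrow> 'a \<Rightarrow> 'b) \<Rightarrow> bool" where
  "is_functor C D Fo Fm \<longleftrightarrow> category C \<and> category D \<and>
     (\<forall>X\<in>Obj C. Fo X \<in> Obj D) \<and>
     (\<forall>X\<in>Obj C. \<forall>Y\<in>Obj C. \<forall>f\<in>Hom C X Y. Fm X Y f \<in> Hom D (Fo X) (Fo Y)) \<and>
     (\<forall>X\<in>Obj C. Fm X X (Idn C X) = Idn D (Fo X)) \<and>
     (\<forall>X\<in>Obj C. \<forall>Y\<in>Obj C. \<forall>Z\<in>Obj C. \<forall>f\<in>Hom C X Y. \<forall>g\<in>Hom C Y Z.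
        Fm X Z (Cmp C X Y Z g f) = Cmp D (Fo X) (Fo Y) (Fo Z) (Fm Y Z g) (Fm X Y f))"

definition fully_faithful_functor ::
  "('o, 'a) cat \<Rightarrow> ('p, 'b) cat \<Rightarrow> ('o \<Rightarrow> 'p) \<Rightarrow> ('o \<Rightarrow> 'o \<Rightarrow> 'a \<Rightarrow> 'b) \<Rightarrow> bool" where
  "fully_faithful_functor C D Fo Fm \<longleftrightarrow> is_functor C D Fo Fm \<and>
     (\<forall>X\<in>Obj C. \<forall>Y\<in>Obj C. bij_betw (Fm X Y) (Hom C X Y) (Hom D (Fo X) (Fo Y)))"


section \<open>Ind-objects\<close>

record ('i, 'u, 'o, 'a) ind_system =
  idx :: "('i, 'u) cat"
  ob :: "'i \<Rightarrow> 'o"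
  mor :: "'i \<Rightarrow> 'i \<Rightarrow> 'u \<Rightarrow> 'a"

definition ind_object :: "('o, 'a) cat \<Rightarrow> ('i, 'u, 'o, 'a) ind_system \<Rightarrow> bool" where
  "ind_object C P \<longleftrightarrow> filtered_category (idx P) \<and> is_functor (idx P) C (ob P) (mor P)"

text \<open>Morphisms in the category of ind-objects are
  \<open>Hom(P, Q) = lim\<^sub>i colim\<^sub>j Hom\<^sub>C(P\<^sub>i, Q\<^sub>j)\<close>. For an object \<open>X\<close> of \<open>C\<close>, the filtered colimit
  \<open>colim\<^sub>j Hom\<^sub>C(X, Q\<^sub>j)\<close> is the quotient of the disjoint union of the \<open>Hom\<^sub>C(X, Q\<^sub>j)\<close> by the
  relation of becoming equal at some later stage.\<close>

definition germ_set :: "('o, 'a) cat \<Rightarrow> ('j, 'u, 'o, 'a) ind_system \<Rightarrow> 'o \<Rightarrow> ('j \<times> 'a) set" where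
  "germ_set C Q X = (SIGMA j:Obj (idx Q). Hom C X (ob Q j))"

definition germ_rel ::
  "('o, 'a) cat \<Rightarrow> ('j, 'u, 'o, 'a) ind_system \<Rightarrow> 'o \<Rightarrow> (('j \<times> 'a) \<times> ('j \<times> 'a)) set" where
  "germ_rel C Q X =
     {((j, f), (j', f')). (j, f) \<in> germ_set C Q X \<and> (j', f') \<in> germ_set C Q X \<and>
        (\<exists>k\<in>Obj (idx Q). \<exists>u\<in>Hom (idx Q) j k. \<exists>u'\<in>Hom (idx Q) j' k.
           Cmp C X (ob Q j) (ob Q k) (mor Q j k u) f =
           Cmp C X (ob Q j') (ob Q k) (mor Q j' k u') f')}"

definition colim_Hom :: "('o, 'a) cat \<Rightarrow> ('j, 'u, 'o, 'a) ind_system \<Rightarrow> 'o \<Rightarrow> ('j \<times> 'a) set set" where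
  "colim_Hom C Q X = germ_set C Q X // germ_rel C Q X"

text \<open>Precomposition \<open>colim\<^sub>j Hom\<^sub>C(Y, Q\<^sub>j) \<rightarrow> colim\<^sub>j Hom\<^sub>C(X, Q\<^sub>j)\<close> with \<open>h : X \<rightarrow> Y\<close>.\<close>

definition precomp ::
  "('o, 'a) cat \<Rightarrow> ('j, 'u, 'o, 'a) ind_system \<Rightarrow> 'o \<Rightarrow> 'o \<Rightarrow> 'a \<Rightarrow> ('j \<times> 'a) set \<Rightarrow> ('j \<times> 'a) set" where
  "precomp C Q X Y h c = (\<Union>(j, f)\<in>c. germ_rel C Q X `` {(j, Cmp C X Y (ob Q j) f h)})"

definition ind_Hom ::
  "('o, 'a) cat \<Rightarrow> ('i, 'u, 'o, 'a) ind_system \<Rightarrow> ('i, 'u, 'o, 'a) ind_system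
     \<Rightarrow> ('i \<Rightarrow> ('i \<times> 'a) set) set" where
  "ind_Hom C P Q =
     {\<phi> \<in> (\<Pi>\<^sub>E i\<in>Obj (idx P). colim_Hom C Q (ob P i)).
        \<forall>i\<in>Obj (idx P). \<forall>i'\<in>Obj (idx P). \<forall>u\<in>Hom (idx P) i i'.
          precomp C Q (ob P i) (ob P i') (mor P i i' u) (\<phi> i') = \<phi> i}"

definition ind_Idn :: "('o, 'a) cat \<Rightarrow> ('i, 'u, 'o, 'a) ind_system \<Rightarrow> 'i \<Rightarrow> ('i \<times> 'a) set" where
  "ind_Idn C P = (\<lambda>i\<in>Obj (idx P). germ_rel C P (ob P i) `` {(i, Idn C (ob P i))})"

text \<open>If \<open>\<phi>\<^sub>i\<close> is represented by \<open>f : P\<^sub>i \<rightarrow> Q\<^sub>j\<close>, then the \<open>i\<close>-th component of the composite is the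
  class of \<open>\<psi>\<^sub>j\<close> precomposed with \<open>f\<close>. The union runs over all representatives.\<close>

definition ind_Cmp ::
  "('o, 'a) cat \<Rightarrow> ('i, 'u, 'o, 'a) ind_system \<Rightarrow> ('i, 'u, 'o, 'a) ind_system
     \<Rightarrow> ('i, 'u, 'o, 'a) ind_system
     \<Rightarrow> ('i \<Rightarrow> ('i \<times> 'a) set) \<Rightarrow> ('i \<Rightarrow> ('i \<times> 'a) set) \<Rightarrow> ('i \<Rightarrow> ('i \<times> 'a) set)" where
  "ind_Cmp C P Q R \<psi> \<phi> =
     (\<lambda>i\<in>Obj (idx P). \<Union>(j, f)\<in>\<phi> i. precomp C R (ob P i) (ob Q j) f (\<psi> j))"

definition Ind ::
  "('o, 'a) cat \<Rightarrow> (('i, 'u, 'o, 'a) ind_system, 'i \<Rightarrow> ('i \<times> 'a) set) cat" where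
  "Ind C = \<lparr>Obj = {P. ind_object C P}, Hom = ind_Hom C, Idn = ind_Idn C, Cmp = ind_Cmp C\<rparr>"


section \<open>The algebra of the noncommutative torus\<close>

text \<open>The series \<open>\<Sum> a\<^sub>m\<^sub>,\<^sub>n U\<^sub>1\<^sup>m U\<^sub>2\<^sup>n\<close> is encoded by its coefficient function.\<close>

type_synonym nct_elt = "int \<times> int \<Rightarrow> complex"

definition rapidly_decreasing :: "nct_elt \<Rightarrow> bool" where
  "rapidly_decreasing a \<longleftrightarrow>
     (\<forall>k::nat. \<exists>B. \<forall>m n. (1 + real_of_int (m\<^sup>2 + n\<^sup>2)) ^ k * cmod (a (m, n)) \<le> B)"

text \<open>From \<open>U\<^sub>1 U\<^sub>2 = exp(2\<pi>i\<theta>) U\<^sub>2 U\<^sub>1\<close> one gets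
  \<open>(U\<^sub>1\<^sup>m U\<^sub>2\<^sup>n) (U\<^sub>1\<^sup>p U\<^sub>2\<^sup>q) = exp(-2\<pi>i\<theta>np) U\<^sub>1\<^sup>m\<^sup>+\<^sup>p U\<^sub>2\<^sup>n\<^sup>+\<^sup>q\<close>; below \<open>p = k - m\<close> and \<open>q = l - n\<close>.\<close>

definition nct_mult :: "real \<Rightarrow> nct_elt \<Rightarrow> nct_elt \<Rightarrow> nct_elt" where
  "nct_mult \<theta> a b = (\<lambda>(k, l). \<Sum>\<^sub>\<infinity>(m, n)\<in>UNIV.
     a (m, n) * b (k - m, l - n) *
     exp (- 2 * complex_of_real pi * \<i> * complex_of_real \<theta> * of_int (n * (k - m))))"

definition nct_scalar :: "complex \<Rightarrow> nct_elt" where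
  "nct_scalar c = (\<lambda>p. if p = (0, 0) then c else 0)"

definition A_theta :: "real \<Rightarrow> nct_elt ring" where
  "A_theta \<theta> = \<lparr>carrier = {a. rapidly_decreasing a}, mult = nct_mult \<theta>, one = nct_scalar 1,
     zero = (\<lambda>_. 0), add = (\<lambda>a b p. a p + b p)\<rparr>"

definition delta :: "complex \<Rightarrow> nct_elt \<Rightarrow> nct_elt" where
  "delta \<tau> a = (\<lambda>(m, n). 2 * complex_of_real pi * \<i> * (of_int m * \<tau> + of_int n) * a (m, n))"


section \<open>Right modules\<close>

text \<open>The record type of left modules is reused for right modules: \<open>a \<odot>\<^bsub>M\<^esub> s\<close> is to be read as the
  right action \<open>s a\<close>. The fields \<open>mult\<close> and \<open>one\<close> of the record play no role.\<close>

locale right_module = R?: ring R + M?: abelian_group M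
  for R :: "('r, 'x) ring_scheme" (structure) and M :: "('r, 'm, 'y) module_scheme" (structure) +
  assumes act_closed: "\<lbrakk>a \<in> carrier R; s \<in> carrier M\<rbrakk> \<Longrightarrow> a \<odot>\<^bsub>M\<^esub> s \<in> carrier M"
    and act_add_scalar: "\<lbrakk>a \<in> carrier R; b \<in> carrier R; s \<in> carrier M\<rbrakk> \<Longrightarrow>
      (a \<oplus>\<^bsub>R\<^esub> b) \<odot>\<^bsub>M\<^esub> s = a \<odot>\<^bsub>M\<^esub> s \<oplus>\<^bsub>M\<^esub> b \<odot>\<^bsub>M\<^esub> s"
    and act_add: "\<lbrakk>a \<in> carrier R; s \<in> carrier M; t \<in> carrier M\<rbrakk> \<Longrightarrow>
      a \<odot>\<^bsub>M\<^esub> (s \<oplus>\<^bsub>M\<^esub> t) = a \<odot>\<^bsub>M\<^esub> s \<oplus>\<^bsub>M\<^esub> a \<odot>\<^bsub>M\<^esub> t"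
    and act_assoc: "\<lbrakk>a \<in> carrier R; b \<in> carrier R; s \<in> carrier M\<rbrakk> \<Longrightarrow>
      (a \<otimes>\<^bsub>R\<^esub> b) \<odot>\<^bsub>M\<^esub> s = b \<odot>\<^bsub>M\<^esub> (a \<odot>\<^bsub>M\<^esub> s)"
    and act_one: "s \<in> carrier M \<Longrightarrow> \<one>\<^bsub>R\<^esub> \<odot>\<^bsub>M\<^esub> s = s"

definition module_Hom ::
  "('r, 'x) ring_scheme \<Rightarrow> ('r, 'm, 'y) module_scheme \<Rightarrow> ('r, 'n, 'z) module_scheme \<Rightarrow> ('m \<Rightarrow> 'n) set"
  where
  "module_Hom R M N = {f \<in> carrier M \<rightarrow>\<^sub>E carrier N.
     (\<forall>s\<in>carrier M. \<forall>t\<in>carrier M. f (s \<oplus>\<^bsub>M\<^esub> t) = f s \<oplus>\<^bsub>N\<^esub> f t) \<and>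
     (\<forall>a\<in>carrier R. \<forall>s\<in>carrier M. f (a \<odot>\<^bsub>M\<^esub> s) = a \<odot>\<^bsub>N\<^esub> f s)}"

text \<open>The right module \<open>R\<^sup>n\<close>.\<close>

definition free_right_module :: "('r, 'x) ring_scheme \<Rightarrow> nat \<Rightarrow> ('r, nat \<Rightarrow> 'r) module" where
  "free_right_module R n = \<lparr>carrier = {..<n} \<rightarrow>\<^sub>E carrier R, mult = undefined, one = undefined,
     zero = (\<lambda>i\<in>{..<n}. \<zero>\<^bsub>R\<^esub>), add = (\<lambda>s t. \<lambda>i\<in>{..<n}. s i \<oplus>\<^bsub>R\<^esub> t i),
     smult = (\<lambda>a s. \<lambda>i\<in>{..<n}. s i \<otimes>\<^bsub>R\<^esub> a)\<rparr>"

text \<open>Finitely generated projective: a direct summand of some \<open>R\<^sup>n\<close>, the inclusion being \<open>e\<close> and the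
  projection \<open>p\<close>.\<close>

definition fin_gen_projective :: "('r, 'x) ring_scheme \<Rightarrow> ('r, 'm, 'y) module_scheme \<Rightarrow> bool" where
  "fin_gen_projective R M \<longleftrightarrow>
     (\<exists>n. \<exists>e\<in>module_Hom R M (free_right_module R n). \<exists>p\<in>module_Hom R (free_right_module R n) M.
        \<forall>s\<in>carrier M. p (e s) = s)"


section \<open>Holomorphic modules and vector bundles\<close>

record ('r, 'm) conn_module = "('r, 'm) module" +
  nabla :: "'m \<Rightarrow> 'm"

locale holomorphic_module = right_module "A_theta \<theta>" M
  for \<theta> :: real and \<tau> :: complex and M :: "(nct_elt, 'm) conn_module" +
  assumes nabla_closed: "s \<in> carrier M \<Longrightarrow> nabla M s \<in> carrier M"
    and nabla_add: "\<lbrakk>s \<in> carrier M; t \<in> carrier M\<rbrakk> \<Longrightarrow>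
      nabla M (s \<oplus>\<^bsub>M\<^esub> t) = nabla M s \<oplus>\<^bsub>M\<^esub> nabla M t"
    and nabla_scalar: "s \<in> carrier M \<Longrightarrow>
      nabla M (nct_scalar c \<odot>\<^bsub>M\<^esub> s) = nct_scalar c \<odot>\<^bsub>M\<^esub> nabla M s"
    and nabla_Leibniz: "\<lbrakk>s \<in> carrier M; a \<in> carrier (A_theta \<theta>)\<rbrakk> \<Longrightarrow>
      nabla M (a \<odot>\<^bsub>M\<^esub> s) = a \<odot>\<^bsub>M\<^esub> nabla M s \<oplus>\<^bsub>M\<^esub> delta \<tau> a \<odot>\<^bsub>M\<^esub> s"

definition HM :: "real \<Rightarrow> complex \<Rightarrow> ((nct_elt, 'm) conn_module, 'm \<Rightarrow> 'm) cat" where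
  "HM \<theta> \<tau> = \<lparr>Obj = {M. holomorphic_module \<theta> \<tau> M},
     Hom = (\<lambda>M N. {f \<in> module_Hom (A_theta \<theta>) M N. \<forall>s\<in>carrier M. f (nabla M s) = nabla N (f s)}),
     Idn = (\<lambda>M. \<lambda>s\<in>carrier M. s),
     Cmp = (\<lambda>L M N g f. compose (carrier L) g f)\<rparr>"

definition Vect :: "real \<Rightarrow> complex \<Rightarrow> ((nct_elt, 'm) conn_module, 'm \<Rightarrow> 'm) cat" where
  "Vect \<theta> \<tau> = full_subcategory (HM \<theta> \<tau>) {M. fin_gen_projective (A_theta \<theta>) M}"

definition Qcoh :: "real \<Rightarrow> complex \<Rightarrow>
  (('i, 'u, (nct_elt, 'm) conn_module, 'm \<Rightarrow> 'm) ind_system, 'i \<Rightarrow> ('i \<times> ('m \<Rightarrow> 'm)) set) cat" where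
  "Qcoh \<theta> \<tau> = Ind (Vect \<theta> \<tau>)"


section \<open>The natural functor\<close>

text \<open>Filtered colimits of holomorphic modules, formed on underlying sets: classes of pairs
  \<open>(i, s)\<close> with \<open>s\<close> in the \<open>i\<close>-th module, identified when they become equal at some later stage.
  All operations are defined on representatives; the unions run over all choices of representatives
  and, for the sum, over all common later stages.\<close>

type_synonym ('i, 'u, 'm) module_system =
  "('i, 'u, (nct_elt, 'm) conn_module, 'm \<Rightarrow> 'm) ind_system"

definition elt_set :: "('i, 'u, 'm) module_system \<Rightarrow> ('i \<times> 'm) set" where
  "elt_set P = (SIGMA i:Obj (idx P). carrier (ob P i))"

definition elt_rel :: "('i, 'u, 'm) module_system \<Rightarrow> (('i \<times> 'm) \<times> ('i \<times> 'm)) set" where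
  "elt_rel P =
     {((i, s), (j, t)). (i, s) \<in> elt_set P \<and> (j, t) \<in> elt_set P \<and>
        (\<exists>k\<in>Obj (idx P). \<exists>u\<in>Hom (idx P) i k. \<exists>v\<in>Hom (idx P) j k. mor P i k u s = mor P j k v t)}"

definition colim :: "('i, 'u, 'm) module_system \<Rightarrow> (nct_elt, ('i \<times> 'm) set) conn_module" where
  "colim P = \<lparr>carrier = elt_set P // elt_rel P, mult = undefined, one = undefined,
     zero = (\<Union>i\<in>Obj (idx P). elt_rel P `` {(i, \<zero>\<^bsub>ob P i\<^esub>)}),
     add = (\<lambda>x y. \<Union>(i, s)\<in>x. \<Union>(j, t)\<in>y.
       \<Union>k\<in>Obj (idx P). \<Union>u\<in>Hom (idx P) i k. \<Union>v\<in>Hom (idx P) j k.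
         elt_rel P `` {(k, mor P i k u s \<oplus>\<^bsub>ob P k\<^esub> mor P j k v t)}),
     smult = (\<lambda>a x. \<Union>(i, s)\<in>x. elt_rel P `` {(i, a \<odot>\<^bsub>ob P i\<^esub> s)}),
     nabla = (\<lambda>x. \<Union>(i, s)\<in>x. elt_rel P `` {(i, nabla (ob P i) s)})\<rparr>"

text \<open>If \<open>x\<close> is represented by \<open>s\<close> in \<open>P\<^sub>i\<close> and \<open>\<phi>\<^sub>i\<close> by \<open>f : P\<^sub>i \<rightarrow> Q\<^sub>j\<close>, then the image of \<open>x\<close> is the class
  of \<open>f s\<close> in \<open>Q\<^sub>j\<close>.\<close>

definition colim_map ::
  "('i, 'u, 'm) module_system \<Rightarrow> ('i, 'u, 'm) module_system
     \<Rightarrow> ('i \<Rightarrow> ('i \<times> ('m \<Rightarrow> 'm)) set) \<Rightarrow> ('i \<times> 'm) set \<Rightarrow> ('i \<times> 'm) set" where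
  "colim_map P Q \<phi> =
     (\<lambda>x\<in>carrier (colim P). \<Union>(i, s)\<in>x. \<Union>(j, f)\<in>\<phi> i. elt_rel Q `` {(j, f s)})"


section \<open>The algebra of the noncommutative torus is a ring\<close>

definition nct_weight :: "int \<times> int \<Rightarrow> real" where "nct_weight p = 1 + real_of_int ((fst p)\<^sup>2 + (snd p)\<^sup>2)"

definition nct_cocycle :: "real \<Rightarrow> int \<times> int \<Rightarrow> int \<times> int \<Rightarrow> complex" where
  "nct_cocycle \<theta> p q = exp (- 2 * complex_of_real pi * \<i> * complex_of_real \<theta> * of_int (snd p * fst q))"

lemma rapidly_decreasing_iff: "rapidly_decreasing a \<longleftrightarrow> (\<forall>k. \<exists>B. \<forall>p. nct_weight p ^ k * cmod (a p) \<le> B)"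
  by (auto simp: rapidly_decreasing_def nct_weight_def)

lemma nct_mult_alt: "nct_mult \<theta> a b x = (\<Sum>\<^sub>\<infinity>y\<in>UNIV. a y * b (x - y) * nct_cocycle \<theta> y (x - y))"
  unfolding nct_mult_def nct_cocycle_def by (cases x) (auto intro!: infsum_cong simp: case_prod_unfold)

lemma norm_nct_cocycle [simp]: "norm (nct_cocycle \<theta> p q) = 1"
proof -
  have "nct_cocycle \<theta> p q = exp (\<i> * of_real (- 2 * pi * \<theta> * of_int (snd p * fst q)))"
    by (simp add: nct_cocycle_def algebra_simps)
  then show ?thesis by (metis norm_exp_i_times)
qed

lemma nct_cocycle_add_left: "nct_cocycle \<theta> (p + q) r = nct_cocycle \<theta> p r * nct_cocycle \<theta> q r"
  by (simp add: nct_cocycle_def flip: exp_add) (simp add: algebra_simps)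

lemma nct_cocycle_add_right: "nct_cocycle \<theta> p (q + r) = nct_cocycle \<theta> p q * nct_cocycle \<theta> p r"
  by (simp add: nct_cocycle_def flip: exp_add) (simp add: algebra_simps)

lemma nct_weight_ge_1: "nct_weight p \<ge> 1" by (simp add: nct_weight_def)

lemma nct_weight_pos: "nct_weight p > 0" using nct_weight_ge_1[of p] by linarith

lemma summable_on_inverse_int_square: "(\<lambda>m::int. 1 / (1 + real_of_int (m\<^sup>2))) summable_on UNIV"
proof -
  let ?f = "\<lambda>m::int. 1 / (1 + real_of_int (m\<^sup>2))"
  have s: "summable (\<lambda>n::nat. 1 / (1 + (real n)\<^sup>2))"
  proof (rule summable_comparison_test')
    show "summable (\<lambda>n::nat. inverse (real n ^ 2))" by (rule inverse_power_summable) simp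
    show "norm (1 / (1 + (real n)\<^sup>2)) \<le> inverse (real n ^ 2)" if "n \<ge> 1" for n
      using that by (simp add: inverse_eq_divide frac_le)
  qed
  then have n: "(\<lambda>n::nat. 1 / (1 + (real n)\<^sup>2)) summable_on UNIV"
    by (subst summable_on_UNIV_nonneg_real_iff) auto
  have 1: "?f summable_on range int"
    by (subst summable_on_reindex) (use n in \<open>auto simp: o_def\<close>)
  have 2: "?f summable_on range (\<lambda>n. - int n)"
    by (subst summable_on_reindex) (use n in \<open>auto simp: o_def inj_def\<close>)
  have "range int \<union> range (\<lambda>n. - int n) = UNIV"
    by (auto, metis int_cases2 rangeI)
  moreover have "?f summable_on (range (\<lambda>n. - int n) - range int)"
    by (rule summable_on_subset_banach[OF 2]) auto
  then have "?f summable_on (range int \<union> (range (\<lambda>n. - int n) - range int))"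
    by (intro summable_on_Un_disjoint 1) auto
  ultimately show ?thesis by (metis Un_Diff_cancel)
qed

lemma summable_on_inverse_nct_weight: "(\<lambda>p. 1 / nct_weight p ^ 2) summable_on UNIV"
proof -
  let ?g = "\<lambda>m::int. 1 / (1 + real_of_int (m\<^sup>2))"
  have "(\<lambda>(m,n). ?g m * ?g n) summable_on (UNIV \<times> UNIV)"
  proof (rule summable_on_SigmaI)
    show "((\<lambda>y. case (x, y) of (m, n) \<Rightarrow> ?g m * ?g n) has_sum (?g x * infsum ?g UNIV)) UNIV" for x
      using has_sum_cmult_right[OF has_sum_infsum[OF summable_on_inverse_int_square], of "?g x"] by simp
    show "(\<lambda>x. ?g x * infsum ?g UNIV) summable_on UNIV"
      by (rule summable_on_cmult_left[OF summable_on_inverse_int_square])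
  qed auto
  then have s: "(\<lambda>p. ?g (fst p) * ?g (snd p)) summable_on UNIV" by (simp add: case_prod_unfold)
  show ?thesis
  proof (rule summable_on_comparison_test[OF s])
    fix p :: "int \<times> int"
    have "(1 + real_of_int ((fst p)\<^sup>2)) * (1 + real_of_int ((snd p)\<^sup>2)) \<le> nct_weight p * nct_weight p"
      by (rule mult_mono) (auto simp: nct_weight_def)
    moreover have "0 < (1 + real_of_int ((fst p)\<^sup>2)) * (1 + real_of_int ((snd p)\<^sup>2))"
      by (intro mult_pos_pos) (auto intro: add_pos_nonneg)
    ultimately show "1 / nct_weight p ^ 2 \<le> ?g (fst p) * ?g (snd p)"
      using nct_weight_pos[of p] by (simp add: power2_eq_square frac_le)
  qed auto
qed

lemma summable_on_nct_weight_mult: assumes "rapidly_decreasing a" shows "(\<lambda>p. nct_weight p ^ k * cmod (a p)) summable_on UNIV"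
proof -
  obtain B where B: "\<And>p. nct_weight p ^ (k + 2) * cmod (a p) \<le> B" using assms rapidly_decreasing_iff by meson
  show ?thesis
  proof (rule summable_on_comparison_test)
    show "(\<lambda>p. B * (1 / nct_weight p ^ 2)) summable_on UNIV" by (rule summable_on_cmult_right[OF summable_on_inverse_nct_weight])
    show "nct_weight p ^ k * cmod (a p) \<le> B * (1 / nct_weight p ^ 2)" for p
      using B[of p] nct_weight_pos[of p] by (simp add: field_simps power_add power2_eq_square)
    show "0 \<le> nct_weight p ^ k * cmod (a p)" for p using nct_weight_pos[of p] by simp
  qed
qed

lemma rapidly_decreasing_abs_summable: assumes "rapidly_decreasing a" shows "(\<lambda>p. cmod (a p)) summable_on UNIV"
  using summable_on_nct_weight_mult[OF assms, of 0] by simp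

lemma rapidly_decreasing_bounded: assumes "rapidly_decreasing a" obtains B where "\<And>p. cmod (a p) \<le> B"
  using assms unfolding rapidly_decreasing_iff by (metis mult_1 power_0)

lemma nct_weight_Peetre: "nct_weight x \<le> 2 * nct_weight y * nct_weight (x - y)"
proof -
  have *: "1 + (s + t)\<^sup>2 + (s' + t')\<^sup>2 \<le> 2 * (1 + s\<^sup>2 + s'\<^sup>2) * (1 + t\<^sup>2 + t'\<^sup>2)" for s t s' t' :: real
  proof -
    have "0 \<le> (s - t)\<^sup>2" "0 \<le> (s' - t')\<^sup>2" "0 \<le> (s\<^sup>2 + s'\<^sup>2) * (t\<^sup>2 + t'\<^sup>2)" by auto
    then show ?thesis by (simp add: power2_eq_square algebra_simps)
  qed
  show ?thesis using *[of "fst y" "fst (x - y)" "snd y" "snd (x - y)"] by (simp add: nct_weight_def add.assoc)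
qed

lemma nct_mult_abs_summable:
  assumes "rapidly_decreasing a" "rapidly_decreasing b"
  shows "(\<lambda>y. cmod (a y * b (x - y) * nct_cocycle \<theta> y (x - y))) summable_on UNIV"
proof -
  obtain B where B: "\<And>p. cmod (b p) \<le> B" using rapidly_decreasing_bounded[OF assms(2)] by blast
  show ?thesis
  proof (rule summable_on_comparison_test)
    show "(\<lambda>y. cmod (a y) * B) summable_on UNIV" by (rule summable_on_cmult_left[OF rapidly_decreasing_abs_summable[OF assms(1)]])
  qed (use B in \<open>auto simp: norm_mult mult_left_mono\<close>)
qed

lemma rapidly_decreasing_nct_mult: assumes "rapidly_decreasing a" "rapidly_decreasing b"
  shows "rapidly_decreasing (nct_mult \<theta> a b)"
  unfolding rapidly_decreasing_iff
proof
  fix k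
  obtain B where B: "\<And>p. nct_weight p ^ k * cmod (b p) \<le> B" using assms(2) rapidly_decreasing_iff by meson
  define S where "S = (\<Sum>\<^sub>\<infinity>y\<in>UNIV. 2 ^ k * B * (nct_weight y ^ k * cmod (a y)))"
  have "nct_weight x ^ k * cmod (nct_mult \<theta> a b x) \<le> S" for x
  proof -
    have cs: "(\<lambda>y. cmod (a y * b (x - y) * nct_cocycle \<theta> y (x - y))) summable_on UNIV"
      using nct_mult_abs_summable[OF assms] .
    have "cmod (nct_mult \<theta> a b x) \<le> (\<Sum>\<^sub>\<infinity>y\<in>UNIV. cmod (a y * b (x - y) * nct_cocycle \<theta> y (x - y)))"
      unfolding nct_mult_alt by (rule norm_infsum_bound[OF cs])
    then have "nct_weight x ^ k * cmod (nct_mult \<theta> a b x)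
        \<le> nct_weight x ^ k * (\<Sum>\<^sub>\<infinity>y\<in>UNIV. cmod (a y * b (x - y) * nct_cocycle \<theta> y (x - y)))"
      using nct_weight_pos[of x] by (simp add: mult_left_mono)
    also have "\<dots> = (\<Sum>\<^sub>\<infinity>y\<in>UNIV. nct_weight x ^ k * cmod (a y * b (x - y) * nct_cocycle \<theta> y (x - y)))"
      by (rule infsum_cmult_right[symmetric]) (use cs in blast)
    also have "\<dots> \<le> S" unfolding S_def
    proof (rule infsum_mono)
      show "(\<lambda>y. nct_weight x ^ k * cmod (a y * b (x - y) * nct_cocycle \<theta> y (x - y))) summable_on UNIV"
        by (rule summable_on_cmult_right[OF cs])
      show "(\<lambda>y. 2 ^ k * B * (nct_weight y ^ k * cmod (a y))) summable_on UNIV"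
        by (rule summable_on_cmult_right[OF summable_on_nct_weight_mult[OF assms(1)]])
      fix y
      have "nct_weight x ^ k \<le> (2 * nct_weight y * nct_weight (x - y)) ^ k"
        using nct_weight_pos[of x] by (intro power_mono nct_weight_Peetre) auto
      then have "nct_weight x ^ k * (cmod (a y) * cmod (b (x - y)))
          \<le> (2 * nct_weight y * nct_weight (x - y)) ^ k * (cmod (a y) * cmod (b (x - y)))"
        by (rule mult_right_mono) auto
      also have "\<dots> = (2 ^ k * nct_weight y ^ k * cmod (a y)) * (nct_weight (x - y) ^ k * cmod (b (x - y)))"
        by (simp add: power_mult_distrib)
      also have "\<dots> \<le> (2 ^ k * nct_weight y ^ k * cmod (a y)) * B"
        by (rule mult_left_mono[OF B]) (use nct_weight_pos[of y] in auto)
      finally show "nct_weight x ^ k * cmod (a y * b (x - y) * nct_cocycle \<theta> y (x - y)) \<le> 2 ^ k * B * (nct_weight y ^ k * cmod (a y))"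
        by (simp add: norm_mult mult_ac)
    qed
    finally show ?thesis .
  qed
  then show "\<exists>B. \<forall>p. nct_weight p ^ k * cmod (nct_mult \<theta> a b p) \<le> B" by blast
qed

lemma rapidly_decreasing_add: assumes "rapidly_decreasing a" "rapidly_decreasing b"
  shows "rapidly_decreasing (\<lambda>p. a p + b p)"
  unfolding rapidly_decreasing_iff
proof
  fix k
  obtain A B where A: "\<And>p. nct_weight p ^ k * cmod (a p) \<le> A" and B: "\<And>p. nct_weight p ^ k * cmod (b p) \<le> B"
    using assms rapidly_decreasing_iff by meson
  have "nct_weight p ^ k * cmod (a p + b p) \<le> A + B" for p
  proof -
    have "nct_weight p ^ k * cmod (a p + b p) \<le> nct_weight p ^ k * (cmod (a p) + cmod (b p))"
      using nct_weight_pos[of p] by (intro mult_left_mono norm_triangle_ineq) auto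
    then show ?thesis using A[of p] B[of p] by (simp add: algebra_simps)
  qed
  then show "\<exists>B. \<forall>p. nct_weight p ^ k * cmod (a p + b p) \<le> B" by blast
qed

lemma rapidly_decreasing_nct_scalar: "rapidly_decreasing (nct_scalar c)"
  unfolding rapidly_decreasing_iff by (intro allI exI[of _ "cmod c"]) (auto simp: nct_scalar_def nct_weight_def)

lemma infsum_UNIV_single:
  fixes f :: "'a \<Rightarrow> complex" assumes "\<And>y. y \<noteq> z \<Longrightarrow> f y = 0" shows "(\<Sum>\<^sub>\<infinity>y\<in>UNIV. f y) = f z"
proof -
  have "(\<Sum>\<^sub>\<infinity>y\<in>UNIV. f y) = (\<Sum>\<^sub>\<infinity>y\<in>{z}. f y)"
    by (rule infsum_cong_neutral) (use assms in auto)
  then show ?thesis by simp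
qed

lemma nct_mult_scalar_left: "nct_mult \<theta> (nct_scalar c) b = (\<lambda>p. c * b p)"
proof
  fix x
  have "nct_mult \<theta> (nct_scalar c) b x = nct_scalar c (0,0) * b (x - (0,0)) * nct_cocycle \<theta> (0,0) (x - (0,0))"
    unfolding nct_mult_alt by (rule infsum_UNIV_single) (auto simp: nct_scalar_def)
  then show "nct_mult \<theta> (nct_scalar c) b x = c * b x" by (simp add: nct_scalar_def nct_cocycle_def flip: zero_prod_def)
qed

lemma nct_mult_scalar_right: "nct_mult \<theta> b (nct_scalar c) = (\<lambda>p. b p * c)"
proof
  fix x
  have "nct_mult \<theta> b (nct_scalar c) x = b x * nct_scalar c (x - x) * nct_cocycle \<theta> x (x - x)"
    unfolding nct_mult_alt by (rule infsum_UNIV_single) (auto simp: nct_scalar_def prod_eq_iff)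
  then show "nct_mult \<theta> b (nct_scalar c) x = b x * c" by (simp add: nct_scalar_def nct_cocycle_def zero_prod_def)
qed

lemma nct_mult_assoc:
  assumes "rapidly_decreasing a" "rapidly_decreasing b" "rapidly_decreasing c"
  shows "nct_mult \<theta> (nct_mult \<theta> a b) c = nct_mult \<theta> a (nct_mult \<theta> b c)"
proof
  fix x
  let ?h = "\<lambda>y z. (a z * b (y - z) * nct_cocycle \<theta> z (y - z)) * (c (x - y) * nct_cocycle \<theta> y (x - y))"
  obtain B where B: "\<And>p. cmod (b p) \<le> B" using rapidly_decreasing_bounded[OF assms(2)] by blast
  have S: "(\<lambda>(z, y). ?h y z) summable_on UNIV \<times> UNIV"
  proof (rule abs_summable_summable, rule summable_on_comparison_test)
    have sc: "(\<lambda>y. cmod (c (x - y))) summable_on UNIV"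
      using rapidly_decreasing_abs_summable[OF assms(3)] summable_on_reindex_bij_witness[of UNIV "\<lambda>y. x - y" "\<lambda>y. x - y" UNIV
         "\<lambda>y. cmod (c y)" "\<lambda>y. cmod (c (x - y))"] by simp
    have 0: "B \<ge> 0" using B[of 0] norm_ge_zero order_trans by blast
    show "(\<lambda>(z, y). (B * cmod (a z)) * cmod (c (x - y))) summable_on UNIV \<times> UNIV"
    proof (rule summable_on_SigmaI)
      show "((\<lambda>y. case (z, y) of (z, y) \<Rightarrow> (B * cmod (a z)) * cmod (c (x - y))) has_sum
         (B * cmod (a z)) * (\<Sum>\<^sub>\<infinity>y\<in>UNIV. cmod (c (x - y)))) UNIV" for z
        using has_sum_cmult_right[OF has_sum_infsum[OF sc]] by simp
      show "(\<lambda>z. (B * cmod (a z)) * (\<Sum>\<^sub>\<infinity>y\<in>UNIV. cmod (c (x - y)))) summable_on UNIV"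
        by (intro summable_on_cmult_left summable_on_cmult_right rapidly_decreasing_abs_summable assms)
    qed (use 0 in auto)
    show "norm (case p of (z, y) \<Rightarrow> ?h y z) \<le> (case p of (z, y) \<Rightarrow> (B * cmod (a z)) * cmod (c (x - y)))" for p
      using mult_right_mono[OF B[of "snd p - fst p"], of "cmod (a (fst p)) * cmod (c (x - snd p))"]
      by (auto simp: norm_mult case_prod_unfold mult_ac)
  qed auto
  have "nct_mult \<theta> (nct_mult \<theta> a b) c x = (\<Sum>\<^sub>\<infinity>y\<in>UNIV. \<Sum>\<^sub>\<infinity>z\<in>UNIV. ?h y z)"
    unfolding nct_mult_alt
    by (subst mult.assoc, intro infsum_cong infsum_cmult_left[symmetric] abs_summable_summable[OF nct_mult_abs_summable] assms)
  also have "\<dots> = (\<Sum>\<^sub>\<infinity>z\<in>UNIV. \<Sum>\<^sub>\<infinity>y\<in>UNIV. ?h y z)"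
    by (rule infsum_swap_banach[symmetric, OF S])
  also have "\<dots> = nct_mult \<theta> a (nct_mult \<theta> b c) x"
    unfolding nct_mult_alt[of _ a]
  proof (rule infsum_cong)
    fix z
    have "(\<Sum>\<^sub>\<infinity>y\<in>UNIV. ?h y z) = (\<Sum>\<^sub>\<infinity>w\<in>UNIV. ?h (z + w) z)"
      by (rule infsum_reindex_bij_witness[of UNIV "\<lambda>w. z + w" "\<lambda>y. y - z"]) auto
    also have "\<dots> = (\<Sum>\<^sub>\<infinity>w\<in>UNIV. a z * nct_cocycle \<theta> z (x - z) * (b w * c (x - z - w) * nct_cocycle \<theta> w (x - z - w)))"
    proof (rule infsum_cong)
      fix w
      have "nct_cocycle \<theta> z (x - z) = nct_cocycle \<theta> z w * nct_cocycle \<theta> z (x - z - w)"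
        by (subst nct_cocycle_add_right[symmetric]) simp
      then show "?h (z + w) z = a z * nct_cocycle \<theta> z (x - z) * (b w * c (x - z - w) * nct_cocycle \<theta> w (x - z - w))"
        by (simp add: nct_cocycle_add_left diff_diff_add mult_ac)
    qed
    also have "\<dots> = a z * nct_cocycle \<theta> z (x - z) * nct_mult \<theta> b c (x - z)"
      unfolding nct_mult_alt by (intro infsum_cmult_right abs_summable_summable[OF nct_mult_abs_summable] assms)
    finally show "(\<Sum>\<^sub>\<infinity>y\<in>UNIV. ?h y z) = a z * nct_mult \<theta> b c (x - z) * nct_cocycle \<theta> z (x - z)"
      by (simp add: mult_ac)
  qed
  finally show "nct_mult \<theta> (nct_mult \<theta> a b) c x = nct_mult \<theta> a (nct_mult \<theta> b c) x" .
qed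

lemma nct_mult_distrib_right:
  assumes "rapidly_decreasing a" "rapidly_decreasing b" "rapidly_decreasing c"
  shows "nct_mult \<theta> (\<lambda>p. a p + b p) c = (\<lambda>p. nct_mult \<theta> a c p + nct_mult \<theta> b c p)"
  unfolding nct_mult_alt
  by (rule ext, subst infsum_add[symmetric])
     (auto intro: abs_summable_summable[OF nct_mult_abs_summable] assms simp: ring_distribs)

lemma nct_mult_distrib_left:
  assumes "rapidly_decreasing a" "rapidly_decreasing b" "rapidly_decreasing c"
  shows "nct_mult \<theta> c (\<lambda>p. a p + b p) = (\<lambda>p. nct_mult \<theta> c a p + nct_mult \<theta> c b p)"
  unfolding nct_mult_alt
  by (rule ext, subst infsum_add[symmetric])
     (auto intro: abs_summable_summable[OF nct_mult_abs_summable] assms simp: ring_distribs)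

lemma ring_A_theta: "ring (A_theta \<theta>)"
proof (rule ringI)
  have u: "\<exists>y\<in>carrier (A_theta \<theta>). y \<oplus>\<^bsub>A_theta \<theta>\<^esub> x = \<zero>\<^bsub>A_theta \<theta>\<^esub>" if "x \<in> carrier (A_theta \<theta>)" for x
    using that by (intro bexI[of _ "\<lambda>p. - x p"]) (auto simp: A_theta_def rapidly_decreasing_def)
  show "abelian_group (A_theta \<theta>)"
    by (rule abelian_groupI) (use u in \<open>auto simp: A_theta_def rapidly_decreasing_add add_ac\<close>, auto simp: rapidly_decreasing_def)
  show "Group.monoid (A_theta \<theta>)"
    by (rule monoidI) (auto simp: A_theta_def rapidly_decreasing_nct_mult rapidly_decreasing_nct_scalar nct_mult_scalar_left nct_mult_scalar_right nct_mult_assoc)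
qed (auto simp: A_theta_def nct_mult_distrib_right nct_mult_distrib_left)

definition nct_U1 :: nct_elt where "nct_U1 = (\<lambda>p. if p = (1,0) then 1 else 0)"

definition nct_U2 :: nct_elt where "nct_U2 = (\<lambda>p. if p = (0,1) then 1 else 0)"

lemma nct_commutation: "nct_mult \<theta> nct_U1 nct_U2 x = exp (2 * pi * \<i> * \<theta>) * nct_mult \<theta> nct_U2 nct_U1 x"
proof -
  have "nct_mult \<theta> nct_U1 nct_U2 x = nct_U1 (1,0) * nct_U2 (x - (1,0)) * nct_cocycle \<theta> (1,0) (x - (1,0))"
    unfolding nct_mult_alt by (rule infsum_UNIV_single) (auto simp: nct_U1_def)
  moreover have "nct_mult \<theta> nct_U2 nct_U1 x = nct_U2 (0,1) * nct_U1 (x - (0,1)) * nct_cocycle \<theta> (0,1) (x - (0,1))"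
    unfolding nct_mult_alt by (rule infsum_UNIV_single) (auto simp: nct_U2_def)
  ultimately show ?thesis
    by (cases x) (auto simp: nct_U1_def nct_U2_def nct_cocycle_def exp_minus)
qed

end

theory Submission
  imports Defs
begin

text \<open>Morphisms out of \<open>colim P\<^sub>i\<close> are compatible families of morphisms out of the \<open>P\<^sub>i\<close>, so the claim
  reduces to compactness of a holomorphic vector bundle \<open>M\<close>: every morphism \<open>M \<rightarrow> colim Q\<^sub>j\<close> factors
  through some \<open>Q\<^sub>j\<close>, uniquely up to passing to a later stage. Finite projectivity gives an
  \<open>A\<^sub>\<theta>\<close>-linear factorisation \<open>f\<close>, and uniqueness is tested on finitely many generators. The linear map
  \<open>f\<close> need not be horizontal, but by the Leibniz rule its defect \<open>f \<nabla> - \<nabla> f\<close> is \<open>A\<^sub>\<theta>\<close>-linear; it vanishes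
  in the colimit, hence on the generators at a later stage, hence altogether at that stage.\<close>

section \<open>Filtered colimits of sets\<close>

text \<open>Lifting the values of a morphism on generators does not by itself give a linear map,
  since relations among the generators would have to be lifted too. A dual basis avoids this: with
  coordinates \<open>e s k\<close> and arbitrary lifts \<open>q k\<close> of the images of the
  generators, the sum of the \<open>q k\<close> times \<open>e s k\<close> is linear in s whatever
  lifts were chosen. Only horizontality is then left, and it amounts to finitely many equations.
  Index categories are filtered categories, not directed posets: parallel arrows may differ, and an
  equality in the colimit is witnessed by a pair of arrows. A finite family of equalities must be
  brought under one single arrow before linear maps can be compared, which is what the coequalising
  half of filteredness provides. Germs of morphisms into an ind-object and elements of a colimit of
  modules are two instances of the same quotient, so the relation and its calculus are developed
  once, for a diagram of sets.\<close>

definition diagram_rel :: "('i, 'u) cat \<Rightarrow> ('i \<Rightarrow> 'x set) \<Rightarrow> ('i \<Rightarrow> 'i \<Rightarrow> 'u \<Rightarrow> 'x \<Rightarrow> 'x)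
    \<Rightarrow> (('i \<times> 'x) \<times> ('i \<times> 'x)) set" where
  "diagram_rel I S T =
     {((i, s), (j, t)). (i, s) \<in> Sigma (Obj I) S \<and> (j, t) \<in> Sigma (Obj I) S \<and>
        (\<exists>k\<in>Obj I. \<exists>u\<in>Hom I i k. \<exists>v\<in>Hom I j k. T i k u s = T j k v t)}"

lemma category_Idn: "category C \<Longrightarrow> X \<in> Obj C \<Longrightarrow> Idn C X \<in> Hom C X X"
  unfolding category_def by blast

lemma category_Cmp:
  "\<lbrakk>category C; X \<in> Obj C; Y \<in> Obj C; Z \<in> Obj C; f \<in> Hom C X Y; g \<in> Hom C Y Z\<rbrakk>
    \<Longrightarrow> Cmp C X Y Z g f \<in> Hom C X Z"
  unfolding category_def by blast

lemma category_Idn_right: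
  "\<lbrakk>category C; X \<in> Obj C; Y \<in> Obj C; f \<in> Hom C X Y\<rbrakk> \<Longrightarrow> Cmp C X X Y f (Idn C X) = f"
  unfolding category_def by blast

lemma category_Idn_left:
  "\<lbrakk>category C; X \<in> Obj C; Y \<in> Obj C; f \<in> Hom C X Y\<rbrakk> \<Longrightarrow> Cmp C X Y Y (Idn C Y) f = f"
  unfolding category_def by blast

lemma category_assoc:
  "\<lbrakk>category C; W \<in> Obj C; X \<in> Obj C; Y \<in> Obj C; Z \<in> Obj C;
    f \<in> Hom C W X; g \<in> Hom C X Y; h \<in> Hom C Y Z\<rbrakk>
    \<Longrightarrow> Cmp C W Y Z h (Cmp C W X Y g f) = Cmp C W X Z (Cmp C X Y Z h g) f"
  unfolding category_def by blast

text \<open>A functor from a filtered category to sets. The functor laws are demanded only on the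
  sets \<open>S i\<close>, because outside them the transition maps of a module system carry no
  information.\<close>

locale filtered_diagram =
  fixes I :: "('i, 'u) cat" and S :: "'i \<Rightarrow> 'x set" and T :: "'i \<Rightarrow> 'i \<Rightarrow> 'u \<Rightarrow> 'x \<Rightarrow> 'x"
  assumes filtered: "filtered_category I"
    and T_closed: "\<lbrakk>i \<in> Obj I; k \<in> Obj I; u \<in> Hom I i k; s \<in> S i\<rbrakk> \<Longrightarrow> T i k u s \<in> S k"
    and T_Idn: "\<lbrakk>i \<in> Obj I; s \<in> S i\<rbrakk> \<Longrightarrow> T i i (Idn I i) s = s"
    and T_Cmp: "\<lbrakk>i \<in> Obj I; j \<in> Obj I; k \<in> Obj I; u \<in> Hom I i j; v \<in> Hom I j k; s \<in> S i\<rbrakk>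
      \<Longrightarrow> T i k (Cmp I i j k v u) s = T j k v (T i j u s)"
begin

abbreviation rel where "rel \<equiv> diagram_rel I S T"

abbreviation cls where "cls i s \<equiv> rel `` {(i, s)}"

lemma cat_I: "category I"
  using filtered by (simp add: filtered_category_def)

lemma common_stage:
  assumes "i \<in> Obj I" "j \<in> Obj I"
  obtains k u v where "k \<in> Obj I" "u \<in> Hom I i k" "v \<in> Hom I j k"
  using filtered assms unfolding filtered_category_def by blast

lemma coequalizing_stage:
  assumes "i \<in> Obj I" "j \<in> Obj I" "u \<in> Hom I i j" "v \<in> Hom I i j"
  obtains k w where "k \<in> Obj I" "w \<in> Hom I j k" "Cmp I i j k w u = Cmp I i j k w v"
  using filtered assms unfolding filtered_category_def by blast

lemma relI:
  "\<lbrakk>i \<in> Obj I; j \<in> Obj I; k \<in> Obj I; s \<in> S i; t \<in> S j; u \<in> Hom I i k; v \<in> Hom I j k;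
    T i k u s = T j k v t\<rbrakk> \<Longrightarrow> ((i, s), (j, t)) \<in> rel"
  by (auto simp: diagram_rel_def)

text \<open>The two witnessing stages k and k' have a common later stage m, but the paths from j to
  m through k and through k' need not agree. A further arrow \<open>w\<close> from m to n
  coequalises them, and the chain from s over t to r closes at n.\<close>

lemma trans_rel: "trans rel"
proof (rule transI)
  fix x y z assume "(x, y) \<in> rel" "(y, z) \<in> rel"
  then obtain i s j t l r k u v k' u' v'
    where x: "x = (i, s)" and z: "z = (l, r)"
      and i: "i \<in> Obj I" and s: "s \<in> S i" and j: "j \<in> Obj I" and t: "t \<in> S j"
      and l: "l \<in> Obj I" and r: "r \<in> S l"
      and k: "k \<in> Obj I" "u \<in> Hom I i k" "v \<in> Hom I j k" "T i k u s = T j k v t"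
      and k': "k' \<in> Obj I" "u' \<in> Hom I j k'" "v' \<in> Hom I l k'" "T j k' u' t = T l k' v' r"
    unfolding diagram_rel_def by blast
  obtain m a b where m: "m \<in> Obj I" "a \<in> Hom I k m" "b \<in> Hom I k' m"
    using common_stage[OF k(1) k'(1)] by blast
  have av: "Cmp I j k m a v \<in> Hom I j m" and bu: "Cmp I j k' m b u' \<in> Hom I j m"
    and au: "Cmp I i k m a u \<in> Hom I i m" and bv: "Cmp I l k' m b v' \<in> Hom I l m"
    using category_Cmp[OF cat_I] i j k k' l m by auto
  obtain n w where n: "n \<in> Obj I" "w \<in> Hom I m n"
      and eq: "Cmp I j m n w (Cmp I j k m a v) = Cmp I j m n w (Cmp I j k' m b u')"
    using coequalizing_stage[OF j m(1) av bu] by blast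
  have "T i n (Cmp I i m n w (Cmp I i k m a u)) s = T m n w (T k m a (T i k u s))"
    using i k m n s au by (simp add: T_Cmp)
  also have "\<dots> = T j n (Cmp I j m n w (Cmp I j k m a v)) t"
    using j k m n t av by (simp add: T_Cmp)
  also have "\<dots> = T m n w (T k' m b (T j k' u' t))"
    unfolding eq using j k' m n t bu by (simp add: T_Cmp)
  also have "\<dots> = T l n (Cmp I l m n w (Cmp I l k' m b v')) r"
    using l k' m n r bv by (simp add: T_Cmp)
  finally show "(x, z) \<in> rel"
    unfolding x z using category_Cmp[OF cat_I] i l m n s r au bv by (intro relI[where k = n]) auto
qed

lemma equiv_rel: "equiv (Sigma (Obj I) S) rel"
proof (rule equivI)
  show "refl_on (Sigma (Obj I) S) rel"
    using category_Idn[OF cat_I] by (force simp: refl_on_def intro: relI)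
  show "sym rel"
    unfolding sym_def diagram_rel_def by (simp split: prod.split) (metis)
qed (use trans_rel in \<open>auto simp: diagram_rel_def\<close>)

lemma cls_eqI:
  "\<lbrakk>i \<in> Obj I; j \<in> Obj I; k \<in> Obj I; s \<in> S i; t \<in> S j; u \<in> Hom I i k; v \<in> Hom I j k;
    T i k u s = T j k v t\<rbrakk> \<Longrightarrow> cls i s = cls j t"
  by (rule equiv_class_eq[OF equiv_rel relI])

lemma cls_eqE:
  assumes "cls i s = cls j t" "i \<in> Obj I" "j \<in> Obj I" "s \<in> S i" "t \<in> S j"
  obtains k u v where "k \<in> Obj I" "u \<in> Hom I i k" "v \<in> Hom I j k" "T i k u s = T j k v t"
proof -
  have "((i, s), (j, t)) \<in> rel"
    using eq_equiv_class[OF assms(1) equiv_rel] assms by blast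
  then show thesis
    using that by (auto simp: diagram_rel_def)
qed

lemma cls_T: "\<lbrakk>i \<in> Obj I; k \<in> Obj I; u \<in> Hom I i k; s \<in> S i\<rbrakk> \<Longrightarrow> cls k (T i k u s) = cls i s"
  by (rule cls_eqI[of k i k _ _ "Idn I k" u]) (auto simp: T_closed T_Idn category_Idn[OF cat_I])

lemma cls_in_quotient: "\<lbrakk>i \<in> Obj I; s \<in> S i\<rbrakk> \<Longrightarrow> cls i s \<in> Sigma (Obj I) S // rel"
  by (auto intro: quotientI)

lemma quotient_cases:
  assumes "x \<in> Sigma (Obj I) S // rel"
  obtains i s where "i \<in> Obj I" "s \<in> S i" "x = cls i s"
  using assms by (auto elim!: quotientE)

text \<open>Operations on classes are defined as unions over all representatives. Such a union
  collapses to its value at one representative once \<open>h\<close> is invariant under transition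
  maps, since equivalent representatives have a common image at a later stage. This is the
  well-definedness argument for all operations in one variable.\<close>

lemma UN_cls:
  assumes "i \<in> Obj I" "s \<in> S i"
    and h: "\<And>i k u s. \<lbrakk>i \<in> Obj I; k \<in> Obj I; u \<in> Hom I i k; s \<in> S i\<rbrakk> \<Longrightarrow> h k (T i k u s) = h i s"
  shows "(\<Union>(j, t)\<in>cls i s. h j t) = h i s"
proof -
  have "h j t = h i s" if "(j, t) \<in> cls i s" for j t
  proof -
    obtain k u v where "j \<in> Obj I" "t \<in> S j" "k \<in> Obj I" "u \<in> Hom I i k" "v \<in> Hom I j k"
        "T i k u s = T j k v t"
      using \<open>(j, t) \<in> cls i s\<close> by (auto simp: diagram_rel_def)
    then show ?thesis
      using h[of i k u s] h[of j k v t] assms(1,2) by simp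
  qed
  moreover have "(i, s) \<in> cls i s"
    using equiv_class_self[OF equiv_rel] assms by blast
  ultimately show ?thesis
    by (blast intro: set_eqI)
qed

section \<open>Finite families of elements and of equations in a filtered colimit\<close>

text \<open>Each induction step moves the elements already lifted and the new one to a common later
  stage. The empty family still needs some stage, which exists because the index category is
  nonempty.\<close>

lemma finite_lift:
  assumes "\<And>a. a < (n::nat) \<Longrightarrow> x a \<in> Sigma (Obj I) S // rel"
  shows "\<exists>k\<in>Obj I. \<exists>s. \<forall>a<n. s a \<in> S k \<and> x a = cls k (s a)"
  using assms
proof (induction n)
  case 0
  then show ?case
    using filtered by (auto simp: filtered_category_def)
next
  case (Suc n)
  then have "\<exists>k\<in>Obj I. \<exists>s. \<forall>a<n. s a \<in> S k \<and> x a = cls k (s a)"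
    by simp
  then obtain j s where j: "j \<in> Obj I" "\<And>a. a < n \<Longrightarrow> s a \<in> S j" "\<And>a. a < n \<Longrightarrow> x a = cls j (s a)"
    by blast
  obtain i r where i: "i \<in> Obj I" "r \<in> S i" "x n = cls i r"
    using quotient_cases[OF Suc.prems[of n]] by blast
  obtain k u v where k: "k \<in> Obj I" "u \<in> Hom I i k" "v \<in> Hom I j k"
    using common_stage[OF i(1) j(1)] by blast
  show ?case
    by (intro bexI[of _ k] exI[of _ "\<lambda>a. if a < n then T j k v (s a) else T i k u r"])
      (use i j k in \<open>auto simp: less_Suc_eq T_closed cls_T\<close>)
qed

text \<open>Equality of classes only gives two arrows \<open>u\<close> and \<open>v\<close> with
  equal values on s and t respectively. Coequalising them yields one arrow that identifies s with
  t.\<close>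

lemma cls_eq_same_stageE:
  assumes "cls j s = cls j t" "j \<in> Obj I" "s \<in> S j" "t \<in> S j"
  obtains k w where "k \<in> Obj I" "w \<in> Hom I j k" "T j k w s = T j k w t"
proof -
  obtain i u v where i: "i \<in> Obj I" "u \<in> Hom I j i" "v \<in> Hom I j i" "T j i u s = T j i v t"
    using cls_eqE[OF assms(1) assms(2) assms(2-4)] by blast
  obtain k w where k: "k \<in> Obj I" "w \<in> Hom I i k" "Cmp I j i k w u = Cmp I j i k w v"
    using coequalizing_stage[OF assms(2) i(1-3)] by blast
  have "T j k (Cmp I j i k w u) s = T j k (Cmp I j i k w u) t"
    using T_Cmp[OF assms(2) i(1) k(1) i(2) k(2) assms(3)] T_Cmp[OF assms(2) i(1) k(1) i(3) k(2) assms(4)] i(4) k(3)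
    by simp
  then show thesis
    using that k(1) category_Cmp[OF cat_I assms(2) i(1) k(1) i(2) k(2)] by blast
qed

text \<open>Equalities obtained so far persist along any further arrow, so it suffices to push the
  last pair to the current stage, equalise it there and compose. The single arrow valid for all
  pairs is what later allows a comparison of linear maps on all generators at once.\<close>

lemma finite_eq:
  assumes "j \<in> Obj I"
    and "\<And>a. a < (n::nat) \<Longrightarrow> s a \<in> S j \<and> t a \<in> S j \<and> cls j (s a) = cls j (t a)"
  shows "\<exists>k\<in>Obj I. \<exists>w\<in>Hom I j k. \<forall>a<n. T j k w (s a) = T j k w (t a)"
  using assms(2)
proof (induction n)
  case 0
  then show ?case
    using assms(1) category_Idn[OF cat_I] by blast
next
  case (Suc n)
  then have "\<exists>k\<in>Obj I. \<exists>w\<in>Hom I j k. \<forall>a<n. T j k w (s a) = T j k w (t a)"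
    by simp
  then obtain i u where i: "i \<in> Obj I" "u \<in> Hom I j i" "\<And>a. a < n \<Longrightarrow> T j i u (s a) = T j i u (t a)"
    by blast
  have n: "s n \<in> S j" "t n \<in> S j" "cls j (s n) = cls j (t n)"
    using Suc.prems by auto
  have "cls i (T j i u (s n)) = cls i (T j i u (t n))"
    using i assms(1) n by (simp add: cls_T)
  then obtain k w where k: "k \<in> Obj I" "w \<in> Hom I i k"
      "T i k w (T j i u (s n)) = T i k w (T j i u (t n))"
    using cls_eq_same_stageE[of i "T j i u (s n)" "T j i u (t n)"] i n T_closed assms(1) by metis
  have "T j k (Cmp I j i k w u) (s a) = T j k (Cmp I j i k w u) (t a)" if "a < Suc n" for a
    using that Suc.prems[OF that] i k assms(1) by (auto simp: T_Cmp less_Suc_eq)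
  then show ?case
    using category_Cmp[OF cat_I assms(1) i(1) k(1) i(2) k(2)] k(1) by blast
qed

end

section \<open>The category of ind-objects\<close>

lemma
  assumes "ind_object C P"
  shows ind_object_category: "category C"
    and ind_object_filtered: "filtered_category (idx P)"
    and ind_object_ob: "i \<in> Obj (idx P) \<Longrightarrow> ob P i \<in> Obj C"
    and ind_object_mor: "\<lbrakk>i \<in> Obj (idx P); k \<in> Obj (idx P); u \<in> Hom (idx P) i k\<rbrakk>
      \<Longrightarrow> mor P i k u \<in> Hom C (ob P i) (ob P k)"
    and ind_object_mor_Idn: "i \<in> Obj (idx P) \<Longrightarrow> mor P i i (Idn (idx P) i) = Idn C (ob P i)"
    and ind_object_mor_Cmp: "\<lbrakk>i \<in> Obj (idx P); j \<in> Obj (idx P); k \<in> Obj (idx P);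
        u \<in> Hom (idx P) i j; v \<in> Hom (idx P) j k\<rbrakk>
      \<Longrightarrow> mor P i k (Cmp (idx P) i j k v u) = Cmp C (ob P i) (ob P j) (ob P k) (mor P j k v) (mor P i j u)"
  using assms unfolding ind_object_def is_functor_def filtered_category_def by simp_all

lemma germ_rel_eq_diagram_rel:
  "germ_rel C Q X = diagram_rel (idx Q) (\<lambda>j. Hom C X (ob Q j))
     (\<lambda>j k u. Cmp C X (ob Q j) (ob Q k) (mor Q j k u))"
  unfolding germ_rel_def diagram_rel_def germ_set_def ..

abbreviation germ :: "('o, 'a) cat \<Rightarrow> ('j, 'u, 'o, 'a) ind_system \<Rightarrow> 'o \<Rightarrow> 'j \<Rightarrow> 'a \<Rightarrow> ('j \<times> 'a) set" where
  "germ C Q X j f \<equiv> germ_rel C Q X `` {(j, f)}"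

text \<open>Instantiates the set-level calculus with the functor sending j to
  \<open>Hom C X (ob Q j)\<close>; its colimit is \<open>colim_Hom C Q X\<close>.\<close>

locale germs =
  fixes C :: "('o, 'a) cat" and Q :: "('j, 'u, 'o, 'a) ind_system" and X :: 'o
  assumes ind_object: "ind_object C Q" and X: "X \<in> Obj C"
begin

sublocale filtered_diagram "idx Q" "\<lambda>j. Hom C X (ob Q j)" "\<lambda>j k u. Cmp C X (ob Q j) (ob Q k) (mor Q j k u)"
  rewrites "diagram_rel (idx Q) (\<lambda>j. Hom C X (ob Q j)) (\<lambda>j k u. Cmp C X (ob Q j) (ob Q k) (mor Q j k u))
    = germ_rel C Q X"
proof -
  note [simp] = ind_object_ob[OF ind_object] ind_object_mor[OF ind_object]
    ind_object_mor_Idn[OF ind_object] ind_object_mor_Cmp[OF ind_object] X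
  note cat = ind_object_category[OF ind_object]
  show "filtered_diagram (idx Q) (\<lambda>j. Hom C X (ob Q j)) (\<lambda>j k u. Cmp C X (ob Q j) (ob Q k) (mor Q j k u))"
    by unfold_locales
      (simp_all add: ind_object_filtered[OF ind_object] category_Cmp[OF cat] category_Idn_left[OF cat]
        category_assoc[OF cat])
qed (simp add: germ_rel_eq_diagram_rel)

lemma colim_Hom_eq: "colim_Hom C Q X = Sigma (Obj (idx Q)) (\<lambda>j. Hom C X (ob Q j)) // germ_rel C Q X"
  by (simp add: colim_Hom_def germ_set_def)

lemmas UN_germ = UN_cls
lemmas germ_eqI = cls_eqI
lemmas germ_T = cls_T

lemma germ_in_colim_Hom: "\<lbrakk>j \<in> Obj (idx Q); f \<in> Hom C X (ob Q j)\<rbrakk> \<Longrightarrow> germ C Q X j f \<in> colim_Hom C Q X"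
  unfolding colim_Hom_eq by (rule cls_in_quotient)

end

lemma germsI: "\<lbrakk>ind_object C Q; X \<in> Obj C\<rbrakk> \<Longrightarrow> germs C Q X"
  by (rule germs.intro)

text \<open>Precomposition with \<open>h\<close> commutes with the transition maps, which act by
  postcomposition; this is associativity in C, so \<open>UN_germ\<close> applies.\<close>

lemma precomp_germ:
  assumes Q: "ind_object C Q" and X: "X \<in> Obj C" and Y: "Y \<in> Obj C" and h: "h \<in> Hom C X Y"
    and j: "j \<in> Obj (idx Q)" and f: "f \<in> Hom C Y (ob Q j)"
  shows "precomp C Q X Y h (germ C Q Y j f) = germ C Q X j (Cmp C X Y (ob Q j) f h)"
  unfolding precomp_def
proof (rule germs.UN_germ[OF germsI[OF Q Y] j f])
  fix i k u s
  assume i: "i \<in> Obj (idx Q)" and k: "k \<in> Obj (idx Q)" and u: "u \<in> Hom (idx Q) i k"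
    and s: "s \<in> Hom C Y (ob Q i)"
  note cat = ind_object_category[OF Q]
  have "Cmp C X Y (ob Q k) (Cmp C Y (ob Q i) (ob Q k) (mor Q i k u) s) h =
      Cmp C X (ob Q i) (ob Q k) (mor Q i k u) (Cmp C X Y (ob Q i) s h)"
    using category_assoc[OF cat X Y, of "ob Q i" "ob Q k" h s "mor Q i k u"] i k u s h
    by (simp add: ind_object_ob[OF Q] ind_object_mor[OF Q])
  then show "germ C Q X k (Cmp C X Y (ob Q k) (Cmp C Y (ob Q i) (ob Q k) (mor Q i k u) s) h) =
      germ C Q X i (Cmp C X Y (ob Q i) s h)"
    using germs.germ_T[OF germsI[OF Q X] i k u, of "Cmp C X Y (ob Q i) s h"]
      category_Cmp[OF cat X Y ind_object_ob[OF Q i] h s] by simp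
qed

section \<open>Representatives and composition of morphisms of ind-objects\<close>

lemma ind_Hom_cases:
  assumes "ind_object C P" "ind_object C Q" "\<phi> \<in> ind_Hom C P Q" "i \<in> Obj (idx P)"
  obtains j f where "j \<in> Obj (idx Q)" "f \<in> Hom C (ob P i) (ob Q j)" "\<phi> i = germ C Q (ob P i) j f"
proof -
  interpret germs C Q "ob P i"
    using assms by (intro germsI ind_object_ob)
  have "\<phi> i \<in> colim_Hom C Q (ob P i)"
    using assms(3,4) by (auto simp: ind_Hom_def)
  then show thesis
    unfolding colim_Hom_eq by (rule quotient_cases) (rule that)
qed

lemma ind_Hom_precomp:
  "\<lbrakk>\<phi> \<in> ind_Hom C P Q; i \<in> Obj (idx P); i' \<in> Obj (idx P); u \<in> Hom (idx P) i i'\<rbrakk>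
    \<Longrightarrow> precomp C Q (ob P i) (ob P i') (mor P i i' u) (\<phi> i') = \<phi> i"
  by (simp add: ind_Hom_def)

text \<open>The compatibility condition in computable form: a representative of the component at i'
  becomes one at i, with the same target stage j, by precomposing with the transition map.\<close>

lemma ind_Hom_mor:
  assumes "ind_object C P" "ind_object C Q" "\<phi> \<in> ind_Hom C P Q"
    and "i \<in> Obj (idx P)" "i' \<in> Obj (idx P)" "u \<in> Hom (idx P) i i'"
    and "j \<in> Obj (idx Q)" "f \<in> Hom C (ob P i') (ob Q j)" "\<phi> i' = germ C Q (ob P i') j f"
  shows "\<phi> i = germ C Q (ob P i) j (Cmp C (ob P i) (ob P i') (ob Q j) f (mor P i i' u))"
  using ind_Hom_precomp[OF assms(3-6)] assms
  by (simp add: precomp_germ ind_object_ob ind_object_mor)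

lemma ind_HomI:
  assumes "\<phi> \<in> extensional (Obj (idx P))"
    and "\<And>i. i \<in> Obj (idx P) \<Longrightarrow> \<phi> i \<in> colim_Hom C Q (ob P i)"
    and "\<And>i i' u. \<lbrakk>i \<in> Obj (idx P); i' \<in> Obj (idx P); u \<in> Hom (idx P) i i'\<rbrakk>
      \<Longrightarrow> precomp C Q (ob P i) (ob P i') (mor P i i' u) (\<phi> i') = \<phi> i"
  shows "\<phi> \<in> ind_Hom C P Q"
  using assms by (auto simp: ind_Hom_def PiE_def)

lemma ind_Hom_eqI:
  assumes "\<phi> \<in> ind_Hom C P Q" "\<psi> \<in> ind_Hom C P Q" "\<And>i. i \<in> Obj (idx P) \<Longrightarrow> \<phi> i = \<psi> i"
  shows "\<phi> = \<psi>"
  using assms unfolding ind_Hom_def by (blast intro: PiE_ext)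

text \<open>Moving the representative f of the component of \<phi> to a later stage of Q also
  changes which component of \<psi> is used. \<open>ind_Hom_mor\<close> for \<psi> expresses the
  earlier component through the later one, and both results agree by associativity.\<close>

lemma ind_Cmp_germ:
  assumes P: "ind_object C P" and Q: "ind_object C Q" and R: "ind_object C R"
    and \<psi>: "\<psi> \<in> ind_Hom C Q R"
    and i: "i \<in> Obj (idx P)" and j: "j \<in> Obj (idx Q)" and f: "f \<in> Hom C (ob P i) (ob Q j)"
    and \<phi>i: "\<phi> i = germ C Q (ob P i) j f"
    and k: "k \<in> Obj (idx R)" and g: "g \<in> Hom C (ob Q j) (ob R k)"
    and \<psi>j: "\<psi> j = germ C R (ob Q j) k g"
  shows "ind_Cmp C P Q R \<psi> \<phi> i = germ C R (ob P i) k (Cmp C (ob P i) (ob Q j) (ob R k) g f)"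
proof -
  note cat = ind_object_category[OF P]
  have Pi: "ob P i \<in> Obj C"
    using P i by (rule ind_object_ob)
  have "(\<Union>(j, f)\<in>germ C Q (ob P i) j f. precomp C R (ob P i) (ob Q j) f (\<psi> j)) =
      precomp C R (ob P i) (ob Q j) f (\<psi> j)"
  proof (rule germs.UN_germ[OF germsI[OF Q Pi] j f])
    fix l m u s
    assume l: "l \<in> Obj (idx Q)" and m: "m \<in> Obj (idx Q)" and u: "u \<in> Hom (idx Q) l m"
      and s: "s \<in> Hom C (ob P i) (ob Q l)"
    obtain n h where n: "n \<in> Obj (idx R)" "h \<in> Hom C (ob Q m) (ob R n)" "\<psi> m = germ C R (ob Q m) n h"
      using ind_Hom_cases[OF Q R \<psi> m] by blast
    have "\<psi> l = germ C R (ob Q l) n (Cmp C (ob Q l) (ob Q m) (ob R n) h (mor Q l m u))"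
      using ind_Hom_mor[OF Q R \<psi> l m u n] .
    then show "precomp C R (ob P i) (ob Q m) (Cmp C (ob P i) (ob Q l) (ob Q m) (mor Q l m u) s) (\<psi> m) =
        precomp C R (ob P i) (ob Q l) s (\<psi> l)"
      using n l m s u Pi R
      by (simp add: precomp_germ ind_object_ob[OF Q] ind_object_ob[OF R] ind_object_mor[OF Q]
          category_Cmp[OF cat] category_assoc[OF cat])
  qed
  also have "\<dots> = germ C R (ob P i) k (Cmp C (ob P i) (ob Q j) (ob R k) g f)"
    unfolding \<psi>j using R Pi ind_object_ob[OF Q j] f k g by (rule precomp_germ)
  finally show ?thesis
    using i \<phi>i by (simp add: ind_Cmp_def)
qed

lemma ind_Idn_in_ind_Hom:
  assumes P: "ind_object C P"
  shows "ind_Idn C P \<in> ind_Hom C P P"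
proof (rule ind_HomI)
  note cat = ind_object_category[OF P]
  note [simp] = ind_object_ob[OF P] ind_object_mor[OF P] category_Idn[OF cat]
  show "ind_Idn C P \<in> extensional (Obj (idx P))"
    by (simp add: ind_Idn_def)
  show "ind_Idn C P i \<in> colim_Hom C P (ob P i)" if "i \<in> Obj (idx P)" for i
    using that by (simp add: ind_Idn_def germs.germ_in_colim_Hom germsI P)
  fix i i' u assume i: "i \<in> Obj (idx P)" "i' \<in> Obj (idx P)" "u \<in> Hom (idx P) i i'"
  have "precomp C P (ob P i) (ob P i') (mor P i i' u) (germ C P (ob P i') i' (Idn C (ob P i'))) =
      germ C P (ob P i) i' (mor P i i' u)"
    using i by (simp add: precomp_germ P category_Idn_left[OF cat])
  \<comment> \<open>The transition map, as a germ at stage i', is the identity germ at stage i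
    pushed along \<open>u\<close>.\<close>
  also have "\<dots> = germ C P (ob P i) i (Idn C (ob P i))"
    using germs.germ_T[OF germsI[OF P] i(1,2,3), of "ob P i" "Idn C (ob P i)"] i
    by (simp add: category_Idn_right[OF cat])
  finally show "precomp C P (ob P i) (ob P i') (mor P i i' u) (ind_Idn C P i') = ind_Idn C P i"
    using i by (simp add: ind_Idn_def)
qed

lemma ind_Cmp_cases:
  assumes "ind_object C P" "ind_object C Q" "ind_object C R" "\<phi> \<in> ind_Hom C P Q" "\<psi> \<in> ind_Hom C Q R"
    and "i \<in> Obj (idx P)"
  obtains j f k g where "j \<in> Obj (idx Q)" "f \<in> Hom C (ob P i) (ob Q j)" "\<phi> i = germ C Q (ob P i) j f"
    "k \<in> Obj (idx R)" "g \<in> Hom C (ob Q j) (ob R k)" "\<psi> j = germ C R (ob Q j) k g"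
    "ind_Cmp C P Q R \<psi> \<phi> i = germ C R (ob P i) k (Cmp C (ob P i) (ob Q j) (ob R k) g f)"
proof -
  obtain j f where j: "j \<in> Obj (idx Q)" "f \<in> Hom C (ob P i) (ob Q j)" "\<phi> i = germ C Q (ob P i) j f"
    using ind_Hom_cases[OF assms(1,2,4,6)] by blast
  obtain k g where k: "k \<in> Obj (idx R)" "g \<in> Hom C (ob Q j) (ob R k)" "\<psi> j = germ C R (ob Q j) k g"
    using ind_Hom_cases[OF assms(2,3,5) j(1)] by blast
  show thesis
    using that[OF j k] ind_Cmp_germ[where \<phi> = \<phi> and \<psi> = \<psi>, OF assms(1-3,5,6) j k] by blast
qed

lemma ind_Cmp_in_ind_Hom:
  assumes P: "ind_object C P" and Q: "ind_object C Q" and R: "ind_object C R"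
    and \<phi>: "\<phi> \<in> ind_Hom C P Q" and \<psi>: "\<psi> \<in> ind_Hom C Q R"
  shows "ind_Cmp C P Q R \<psi> \<phi> \<in> ind_Hom C P R"
proof (rule ind_HomI)
  note cat = ind_object_category[OF P]
  note [simp] = ind_object_ob[OF P] ind_object_ob[OF Q] ind_object_ob[OF R] ind_object_mor[OF P]
    category_Cmp[OF cat]
  show "ind_Cmp C P Q R \<psi> \<phi> \<in> extensional (Obj (idx P))"
    by (simp add: ind_Cmp_def)
  show "ind_Cmp C P Q R \<psi> \<phi> i \<in> colim_Hom C R (ob P i)" if i: "i \<in> Obj (idx P)" for i
    by (rule ind_Cmp_cases[OF P Q R \<phi> \<psi> i]) (use i in \<open>simp add: germs.germ_in_colim_Hom germsI R\<close>)
  fix i i' u assume i: "i \<in> Obj (idx P)" and i': "i' \<in> Obj (idx P)" and u: "u \<in> Hom (idx P) i i'"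
  obtain j f k g where j: "j \<in> Obj (idx Q)" "f \<in> Hom C (ob P i') (ob Q j)" "\<phi> i' = germ C Q (ob P i') j f"
    and k: "k \<in> Obj (idx R)" "g \<in> Hom C (ob Q j) (ob R k)" "\<psi> j = germ C R (ob Q j) k g"
    and eq: "ind_Cmp C P Q R \<psi> \<phi> i' = germ C R (ob P i') k (Cmp C (ob P i') (ob Q j) (ob R k) g f)"
    using ind_Cmp_cases[OF P Q R \<phi> \<psi> i'] by blast
  have "ind_Cmp C P Q R \<psi> \<phi> i = germ C R (ob P i) k
      (Cmp C (ob P i) (ob Q j) (ob R k) g (Cmp C (ob P i) (ob P i') (ob Q j) f (mor P i i' u)))"
    using ind_Hom_mor[OF P Q \<phi> i i' u j] i i' u j k by (intro ind_Cmp_germ[OF P Q R \<psi>]) simp_all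
  then show "precomp C R (ob P i) (ob P i') (mor P i i' u) (ind_Cmp C P Q R \<psi> \<phi> i') = ind_Cmp C P Q R \<psi> \<phi> i"
    unfolding eq using i i' u j k by (simp add: precomp_germ R category_assoc[OF cat])
qed

text \<open>Every law is checked componentwise on representatives, where it becomes the
  corresponding law of C. For associativity, \<open>ind_Cmp_germ\<close> lets both bracketings be
  evaluated on the same f, g and h.\<close>

lemma category_Ind:
  fixes C :: "('o, 'a) cat"
  assumes cat: "category C"
  shows "category (Ind C :: (('i, 'u, 'o, 'a) ind_system, 'i \<Rightarrow> ('i \<times> 'a) set) cat)"
proof -
  note [simp] = ind_object_ob ind_Cmp_in_ind_Hom ind_Idn_in_ind_Hom category_Cmp[OF cat] category_Idn[OF cat]
  have r: "ind_Cmp C P P Q \<phi> (ind_Idn C P) = \<phi>"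
    if P: "ind_object C P" and Q: "ind_object C Q" and \<phi>: "\<phi> \<in> ind_Hom C P Q" for P Q :: "('i, 'u, 'o, 'a) ind_system" and \<phi>
  proof (rule ind_Hom_eqI[of _ C P Q])
    fix i assume i: "i \<in> Obj (idx P)"
    obtain j f where j: "j \<in> Obj (idx Q)" "f \<in> Hom C (ob P i) (ob Q j)" "\<phi> i = germ C Q (ob P i) j f"
      using ind_Hom_cases[OF P Q \<phi> i] by blast
    show "ind_Cmp C P P Q \<phi> (ind_Idn C P) i = \<phi> i"
      using ind_Cmp_germ[of C P P Q \<phi> i i "Idn C (ob P i)" "ind_Idn C P" j f] i j P Q \<phi>
      by (simp add: ind_Idn_def category_Idn_right[OF cat])
  qed (use that in simp_all)
  have l: "ind_Cmp C P Q Q (ind_Idn C Q) \<phi> = \<phi>"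
    if P: "ind_object C P" and Q: "ind_object C Q" and \<phi>: "\<phi> \<in> ind_Hom C P Q" for P Q :: "('i, 'u, 'o, 'a) ind_system" and \<phi>
  proof (rule ind_Hom_eqI[of _ C P Q])
    fix i assume i: "i \<in> Obj (idx P)"
    obtain j f where j: "j \<in> Obj (idx Q)" "f \<in> Hom C (ob P i) (ob Q j)" "\<phi> i = germ C Q (ob P i) j f"
      using ind_Hom_cases[OF P Q \<phi> i] by blast
    show "ind_Cmp C P Q Q (ind_Idn C Q) \<phi> i = \<phi> i"
      using ind_Cmp_germ[of C P Q Q "ind_Idn C Q" i j f \<phi> j "Idn C (ob Q j)"] i j P Q
        ind_Idn_in_ind_Hom[OF Q]
      by (simp add: ind_Idn_def category_Idn_left[OF cat])
  qed (use that in simp_all)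
  have a: "ind_Cmp C N Q S \<omega> (ind_Cmp C N P Q \<psi> \<phi>) = ind_Cmp C N P S (ind_Cmp C P Q S \<omega> \<psi>) \<phi>"
    if N: "ind_object C N" and P: "ind_object C P" and Q: "ind_object C Q" and S: "ind_object C S"
      and \<phi>: "\<phi> \<in> ind_Hom C N P" and \<psi>: "\<psi> \<in> ind_Hom C P Q" and \<omega>: "\<omega> \<in> ind_Hom C Q S"
    for N P Q S :: "('i, 'u, 'o, 'a) ind_system" and \<phi> \<psi> \<omega>
  proof (rule ind_Hom_eqI[of _ C N S])
    fix i assume i: "i \<in> Obj (idx N)"
    obtain j f k g where j: "j \<in> Obj (idx P)" "f \<in> Hom C (ob N i) (ob P j)" "\<phi> i = germ C P (ob N i) j f"
      and k: "k \<in> Obj (idx Q)" "g \<in> Hom C (ob P j) (ob Q k)" "\<psi> j = germ C Q (ob P j) k g"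
      and c: "ind_Cmp C N P Q \<psi> \<phi> i = germ C Q (ob N i) k (Cmp C (ob N i) (ob P j) (ob Q k) g f)"
      using ind_Cmp_cases[OF N P Q \<phi> \<psi> i] by blast
    obtain l h where l: "l \<in> Obj (idx S)" "h \<in> Hom C (ob Q k) (ob S l)" "\<omega> k = germ C S (ob Q k) l h"
      using ind_Hom_cases[OF Q S \<omega> k(1)] by blast
    have "Cmp C (ob N i) (ob P j) (ob Q k) g f \<in> Hom C (ob N i) (ob Q k)"
      and "Cmp C (ob P j) (ob Q k) (ob S l) h g \<in> Hom C (ob P j) (ob S l)"
      using i j k l N P Q S by simp_all
    then show "ind_Cmp C N Q S \<omega> (ind_Cmp C N P Q \<psi> \<phi>) i = ind_Cmp C N P S (ind_Cmp C P Q S \<omega> \<psi>) \<phi> i"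
      using ind_Cmp_germ[where \<phi> = "ind_Cmp C N P Q \<psi> \<phi>" and \<psi> = \<omega>, OF N Q S \<omega> i k(1) _ c l]
        ind_Cmp_germ[where \<phi> = \<phi> and \<psi> = "ind_Cmp C P Q S \<omega> \<psi>", OF N P S _ i j l(1) _
          ind_Cmp_germ[where \<phi> = \<psi> and \<psi> = \<omega>, OF P Q S \<omega> j(1) k l]] i j k l N P Q S \<psi> \<omega>
      by (simp add: category_assoc[OF cat])
  qed (use that in simp_all)
  show ?thesis
    unfolding category_def Ind_def using r l a by simp
qed

section \<open>Right modules\<close>

lemma
  assumes "f \<in> module_Hom R M N"
  shows module_Hom_closed: "s \<in> carrier M \<Longrightarrow> f s \<in> carrier N"
    and module_Hom_add: "\<lbrakk>s \<in> carrier M; t \<in> carrier M\<rbrakk> \<Longrightarrow> f (s \<oplus>\<^bsub>M\<^esub> t) = f s \<oplus>\<^bsub>N\<^esub> f t"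
    and module_Hom_act: "\<lbrakk>a \<in> carrier R; s \<in> carrier M\<rbrakk> \<Longrightarrow> f (a \<odot>\<^bsub>M\<^esub> s) = a \<odot>\<^bsub>N\<^esub> f s"
    and module_Hom_extensional: "f \<in> extensional (carrier M)"
  using assms by (auto simp: module_Hom_def PiE_def)

text \<open>Homomorphisms, actions and connections are only assumed additive; that they preserve
  zero follows from this cancellation.\<close>

lemma (in abelian_group) eq_zero_if_add_self: "\<lbrakk>x \<in> carrier G; x \<oplus> x = x\<rbrakk> \<Longrightarrow> x = \<zero>"
  using add.l_cancel_one by blast

lemma module_Hom_zero:
  assumes M: "right_module R M" and N: "right_module R N" and f: "f \<in> module_Hom R M N"
  shows "f \<zero>\<^bsub>M\<^esub> = \<zero>\<^bsub>N\<^esub>"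
proof -
  interpret M: right_module R M by fact
  interpret N: right_module R N by fact
  show ?thesis
    using module_Hom_add[OF f, of "\<zero>\<^bsub>M\<^esub>" "\<zero>\<^bsub>M\<^esub>"] module_Hom_closed[OF f]
    by (intro N.M.eq_zero_if_add_self) simp_all
qed

lemma (in right_module) act_zero: "a \<in> carrier R \<Longrightarrow> a \<odot>\<^bsub>M\<^esub> \<zero>\<^bsub>M\<^esub> = \<zero>\<^bsub>M\<^esub>"
  using act_add[of a "\<zero>\<^bsub>M\<^esub>" "\<zero>\<^bsub>M\<^esub>"] by (intro M.eq_zero_if_add_self) (simp_all add: act_closed)

text \<open>In right-module notation the sum of the \<open>q k\<close> times \<open>v k\<close>:
  generators \<open>q\<close>, coefficients \<open>v\<close> on the right. Recursion on the length
  makes partial sums available for induction.\<close>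

primrec lincomb :: "('r, 'm, 'y) module_scheme \<Rightarrow> (nat \<Rightarrow> 'm) \<Rightarrow> (nat \<Rightarrow> 'r) \<Rightarrow> nat \<Rightarrow> 'm" where
  "lincomb M q v 0 = \<zero>\<^bsub>M\<^esub>"
| "lincomb M q v (Suc n) = lincomb M q v n \<oplus>\<^bsub>M\<^esub> v n \<odot>\<^bsub>M\<^esub> q n"

lemma lincomb_cong:
  "\<lbrakk>\<And>k. k < n \<Longrightarrow> q k = q' k; \<And>k. k < n \<Longrightarrow> v k = v' k\<rbrakk> \<Longrightarrow> lincomb M q v n = lincomb M q' v' n"
  by (induction n) simp_all

context right_module
begin

lemma lincomb_closed:
  "\<lbrakk>\<And>k. k < n \<Longrightarrow> q k \<in> carrier M; \<And>k. k < n \<Longrightarrow> v k \<in> carrier R\<rbrakk> \<Longrightarrow> lincomb M q v n \<in> carrier M"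
  by (induction n) (simp_all add: act_closed)

lemma lincomb_add:
  "\<lbrakk>\<And>k. k < n \<Longrightarrow> q k \<in> carrier M; \<And>k. k < n \<Longrightarrow> v k \<in> carrier R; \<And>k. k < n \<Longrightarrow> w k \<in> carrier R\<rbrakk>
    \<Longrightarrow> lincomb M q (\<lambda>k. v k \<oplus>\<^bsub>R\<^esub> w k) n = lincomb M q v n \<oplus>\<^bsub>M\<^esub> lincomb M q w n"
  by (induction n) (simp_all add: lincomb_closed act_closed act_add_scalar M.a_ac)

text \<open>A scalar acting on a right module multiplies each coefficient from the right, by
  \<open>act_assoc\<close>.\<close>

lemma lincomb_act:
  "\<lbrakk>\<And>k. k < n \<Longrightarrow> q k \<in> carrier M; \<And>k. k < n \<Longrightarrow> v k \<in> carrier R; a \<in> carrier R\<rbrakk>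
    \<Longrightarrow> lincomb M q (\<lambda>k. v k \<otimes>\<^bsub>R\<^esub> a) n = a \<odot>\<^bsub>M\<^esub> lincomb M q v n"
  by (induction n) (simp_all add: lincomb_closed act_closed act_add act_assoc act_zero)

end

lemma module_Hom_lincomb:
  assumes M: "right_module R M" and N: "right_module R N" and f: "f \<in> module_Hom R M N"
    and "\<And>k. k < n \<Longrightarrow> q k \<in> carrier M" "\<And>k. k < n \<Longrightarrow> v k \<in> carrier R"
  shows "f (lincomb M q v n) = lincomb N (\<lambda>k. f (q k)) v n"
proof -
  interpret M: right_module R M by fact
  show ?thesis
    using assms(4,5)
    by (induction n)
      (simp_all add: module_Hom_zero[OF M N f] module_Hom_add[OF f] module_Hom_act[OF f] M.lincomb_closed M.act_closed)
qed

text \<open>The coordinates of the inclusion into \<open>R\<^sup>n\<close> and the images of the standard basis of \<open>R\<^sup>n\<close> form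
  a dual basis.\<close>

lemma fin_gen_projective_dual_basis:
  assumes M: "right_module R M" and fgp: "fin_gen_projective R M"
  obtains n m e where "\<And>k. k < n \<Longrightarrow> m k \<in> carrier M"
    and "\<And>s k. \<lbrakk>s \<in> carrier M; k < n\<rbrakk> \<Longrightarrow> e s k \<in> carrier R"
    and "\<And>s t k. \<lbrakk>s \<in> carrier M; t \<in> carrier M; k < n\<rbrakk> \<Longrightarrow> e (s \<oplus>\<^bsub>M\<^esub> t) k = e s k \<oplus>\<^bsub>R\<^esub> e t k"
    and "\<And>a s k. \<lbrakk>a \<in> carrier R; s \<in> carrier M; k < n\<rbrakk> \<Longrightarrow> e (a \<odot>\<^bsub>M\<^esub> s) k = e s k \<otimes>\<^bsub>R\<^esub> a"
    and "\<And>s. s \<in> carrier M \<Longrightarrow> lincomb M m (e s) n = s"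
proof -
  interpret right_module R M by fact
  obtain n e p where e: "e \<in> module_Hom R M (free_right_module R n)"
      and p: "p \<in> module_Hom R (free_right_module R n) M"
      and pe: "\<And>s. s \<in> carrier M \<Longrightarrow> p (e s) = s"
    using fgp unfolding fin_gen_projective_def by blast
  let ?F = "free_right_module R n"
  define b where "b k = (\<lambda>i\<in>{..<n}. if i = k then \<one>\<^bsub>R\<^esub> else \<zero>\<^bsub>R\<^esub>)" for k
  have b: "b k \<in> carrier ?F" for k
    by (auto simp: b_def free_right_module_def)
  have p_lincomb: "p v = lincomb M (\<lambda>k. p (b k)) v n" if v: "v \<in> carrier ?F" for v
  proof -
    have v_closed: "v k \<in> carrier R" if "k < n" for k
      using v that by (auto simp: free_right_module_def)
    \<comment> \<open>The truncation of v to its first k coordinates. Passing from k to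
      \<open>Suc k\<close> adds the basis vector \<open>b k\<close> times \<open>v k\<close>, which
      matches the recursion of \<open>lincomb\<close>.\<close>
    define w where "w k = (\<lambda>i\<in>{..<n}. if i < k then v i else \<zero>\<^bsub>R\<^esub>)" for k
    have w: "w k \<in> carrier ?F" for k
      using v_closed by (auto simp: w_def free_right_module_def)
    have "p (w k) = lincomb M (\<lambda>k. p (b k)) v k" if "k \<le> n" for k
      using that
    proof (induction k)
      case 0
      \<comment> \<open>That \<open>?F\<close> is a right module is not established, so
        \<open>module_Hom_zero\<close> cannot be applied; idempotence of the zero vector
        suffices.\<close>
      have "w 0 \<oplus>\<^bsub>?F\<^esub> w 0 = w 0"
        by (auto simp: w_def free_right_module_def)
      then have "p (w 0) = \<zero>\<^bsub>M\<^esub>"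
        using module_Hom_add[OF p w w, of 0 0] module_Hom_closed[OF p w[of 0]]
        by (intro M.eq_zero_if_add_self) simp_all
      then show ?case
        by simp
    next
      case (Suc k)
      have "w (Suc k) = w k \<oplus>\<^bsub>?F\<^esub> v k \<odot>\<^bsub>?F\<^esub> b k"
        using Suc.prems v_closed
        by (auto simp: w_def b_def free_right_module_def less_Suc_eq intro!: restrict_ext)
      moreover have "v k \<odot>\<^bsub>?F\<^esub> b k \<in> carrier ?F"
        using Suc.prems v_closed by (auto simp: b_def free_right_module_def)
      ultimately show ?case
        using Suc v_closed by (simp add: module_Hom_add[OF p w] module_Hom_act[OF p _ b])
    qed
    moreover have "w n = v"
      using v by (auto simp: w_def free_right_module_def fun_eq_iff PiE_def extensional_def)
    ultimately show ?thesis
      by force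
  qed
  show thesis
  proof (rule that[of n "\<lambda>k. p (b k)" e])
    show "p (b k) \<in> carrier M" for k
      by (rule module_Hom_closed[OF p b])
    show "e s k \<in> carrier R" if "s \<in> carrier M" "k < n" for s k
      using module_Hom_closed[OF e that(1)] that(2) by (auto simp: free_right_module_def)
    show "e (s \<oplus>\<^bsub>M\<^esub> t) k = e s k \<oplus>\<^bsub>R\<^esub> e t k" if "s \<in> carrier M" "t \<in> carrier M" "k < n" for s t k
      using module_Hom_add[OF e that(1,2)] that(3) by (simp add: free_right_module_def)
    show "e (a \<odot>\<^bsub>M\<^esub> s) k = e s k \<otimes>\<^bsub>R\<^esub> a" if "a \<in> carrier R" "s \<in> carrier M" "k < n" for a s k
      using module_Hom_act[OF e that(1,2)] that(3) by (simp add: free_right_module_def)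
    show "lincomb M (\<lambda>k. p (b k)) (e s) n = s" if "s \<in> carrier M" for s
      using p_lincomb[OF module_Hom_closed[OF e that]] pe[OF that] by simp
  qed
qed

section \<open>Holomorphic modules\<close>

text \<open>The derivation multiplies coefficients by a factor of at most linear growth, which one
  extra power of the weight absorbs. Closure is needed because \<open>delta \<tau> a\<close> acts on
  sections in the Leibniz rule.\<close>

lemma rapidly_decreasing_delta:
  assumes "rapidly_decreasing a"
  shows "rapidly_decreasing (delta \<tau> a)"
  unfolding rapidly_decreasing_iff
proof
  fix k
  obtain B where B: "\<And>p. nct_weight p ^ (k + 1) * cmod (a p) \<le> B"
    using assms rapidly_decreasing_iff by meson
  \<comment> \<open>Comes from bounding the modulus of m \<tau> + n by the weight times (cmod \<tau>
    + 1), together with the factor 2 pi.\<close>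
  define D where "D = 2 * pi * (cmod \<tau> + 1)"
  have "nct_weight p ^ k * cmod (delta \<tau> a p) \<le> D * B" for p
  proof -
    obtain m n where p: "p = (m, n)"
      by (cases p)
    \<comment> \<open>Integrality matters: the inequality fails for nonzero reals of modulus below
      1.\<close>
    have sq: "\<bar>real_of_int i\<bar> \<le> real_of_int (i\<^sup>2)" for i
    proof -
      have "\<bar>i\<bar> \<le> i\<^sup>2"
        using self_le_power[of "\<bar>i\<bar>" 2] by (cases "i = 0") auto
      then show ?thesis
        by linarith
    qed
    have m: "\<bar>real_of_int m\<bar> \<le> nct_weight p" and n: "\<bar>real_of_int n\<bar> \<le> nct_weight p"
      using sq[of m] sq[of n] by (simp_all add: nct_weight_def p)
    have "cmod (of_int m * \<tau> + of_int n) \<le> \<bar>real_of_int m\<bar> * cmod \<tau> + \<bar>real_of_int n\<bar>"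
      by (metis norm_mult norm_of_int norm_triangle_ineq)
    also have "\<dots> \<le> nct_weight p * cmod \<tau> + nct_weight p"
      using m n by (intro add_mono mult_right_mono) simp_all
    finally have "cmod (of_int m * \<tau> + of_int n) \<le> nct_weight p * (cmod \<tau> + 1)"
      by (simp add: algebra_simps)
    then have "cmod (of_int m * \<tau> + of_int n) * cmod (a p) \<le> nct_weight p * (cmod \<tau> + 1) * cmod (a p)"
      by (rule mult_right_mono) simp
    then have "2 * pi * (cmod (of_int m * \<tau> + of_int n) * cmod (a p)) \<le>
        2 * pi * (nct_weight p * (cmod \<tau> + 1) * cmod (a p))"
      by (rule mult_left_mono) simp
    also have "\<dots> = D * (nct_weight p * cmod (a p))"
      by (simp add: D_def)
    finally have "2 * pi * (cmod (of_int m * \<tau> + of_int n) * cmod (a p)) \<le> D * (nct_weight p * cmod (a p))" .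
    moreover have "cmod (delta \<tau> a p) = 2 * pi * (cmod (of_int m * \<tau> + of_int n) * cmod (a p))"
      by (simp add: delta_def p norm_mult)
    ultimately have "nct_weight p ^ k * cmod (delta \<tau> a p) \<le> nct_weight p ^ k * (D * (nct_weight p * cmod (a p)))"
      using nct_weight_pos[of p] by (intro mult_left_mono) simp_all
    also have "\<dots> = D * (nct_weight p ^ (k + 1) * cmod (a p))"
      by (simp add: mult_ac)
    also have "\<dots> \<le> D * B"
      using B[of p] by (intro mult_left_mono) (simp_all add: D_def)
    finally show ?thesis .
  qed
  then show "\<exists>B. \<forall>p. nct_weight p ^ k * cmod (delta \<tau> a p) \<le> B"
    by blast
qed

lemma delta_closed: "a \<in> carrier (A_theta \<theta>) \<Longrightarrow> delta \<tau> a \<in> carrier (A_theta \<theta>)"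
  by (simp add: A_theta_def rapidly_decreasing_delta)

lemma nct_scalar_closed: "nct_scalar c \<in> carrier (A_theta \<theta>)"
  by (simp add: A_theta_def rapidly_decreasing_nct_scalar)

lemma Obj_HM: "M \<in> Obj (HM \<theta> \<tau>) \<longleftrightarrow> holomorphic_module \<theta> \<tau> M"
  by (simp add: HM_def)

lemma Hom_HM: "f \<in> Hom (HM \<theta> \<tau>) M N \<longleftrightarrow>
    f \<in> module_Hom (A_theta \<theta>) M N \<and> (\<forall>s\<in>carrier M. f (nabla M s) = nabla N (f s))"
  by (simp add: HM_def)

lemma Idn_HM: "Idn (HM \<theta> \<tau>) M = (\<lambda>s\<in>carrier M. s)"
  by (simp add: HM_def)

lemma Cmp_HM: "Cmp (HM \<theta> \<tau>) L M N g f = compose (carrier L) g f"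
  by (simp add: HM_def)

lemma holomorphic_module_right_module: "holomorphic_module \<theta> \<tau> M \<Longrightarrow> right_module (A_theta \<theta>) M"
  by (rule holomorphic_module.axioms)

lemma module_Hom_compose:
  assumes "right_module R L" "f \<in> module_Hom R L M" "g \<in> module_Hom R M N"
  shows "compose (carrier L) g f \<in> module_Hom R L N"
proof -
  interpret right_module R L by fact
  show ?thesis
    using module_Hom_closed[OF assms(2)] module_Hom_add[OF assms(2)] module_Hom_act[OF assms(2)]
      module_Hom_closed[OF assms(3)] module_Hom_add[OF assms(3)] module_Hom_act[OF assms(3)]
    by (simp add: module_Hom_def compose_eq act_closed PiE_def Pi_def)
qed

text \<open>Morphisms are extensional functions, and identity and composition are restricted to the
  carrier; therefore the laws hold as equalities of functions on the whole type.\<close>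

lemma category_HM: "category (HM \<theta> \<tau>)"
proof -
  have id: "(\<lambda>s\<in>carrier M. s) \<in> Hom (HM \<theta> \<tau>) M M" if "holomorphic_module \<theta> \<tau> M" for M :: "(nct_elt, 'm) conn_module"
  proof -
    interpret holomorphic_module \<theta> \<tau> M by fact
    show ?thesis
      by (simp add: Hom_HM module_Hom_def nabla_closed act_closed)
  qed
  have comp: "compose (carrier L) g f \<in> Hom (HM \<theta> \<tau>) L N"
    if "holomorphic_module \<theta> \<tau> L" "f \<in> Hom (HM \<theta> \<tau>) L M" "g \<in> Hom (HM \<theta> \<tau>) M N"
    for L M N :: "(nct_elt, 'm) conn_module" and f g
  proof -
    interpret holomorphic_module \<theta> \<tau> L by fact
    show ?thesis
      using that module_Hom_compose[OF right_module_axioms, of f M g N]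
      by (auto simp: Hom_HM compose_eq nabla_closed module_Hom_closed)
  qed
  have ext: "f \<in> carrier M \<rightarrow> carrier N" "f \<in> extensional (carrier M)"
    if "f \<in> Hom (HM \<theta> \<tau>) M N" for M N :: "(nct_elt, 'm) conn_module" and f
    using that by (auto simp: Hom_HM module_Hom_def PiE_def)
  show ?thesis
    unfolding category_def
  proof (intro conjI ballI)
    fix W X Y Z f g h
    assume "W \<in> Obj (HM \<theta> \<tau>)" "X \<in> Obj (HM \<theta> \<tau>)" "Y \<in> Obj (HM \<theta> \<tau>)" "Z \<in> Obj (HM \<theta> \<tau>)"
      and f: "f \<in> Hom (HM \<theta> \<tau>) W X" and "g \<in> Hom (HM \<theta> \<tau>) X Y" "h \<in> Hom (HM \<theta> \<tau>) Y Z"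
    have "f \<in> carrier W \<rightarrow> carrier X"
      using f by (rule ext)
    then show "Cmp (HM \<theta> \<tau>) W Y Z h (Cmp (HM \<theta> \<tau>) W X Y g f) =
        Cmp (HM \<theta> \<tau>) W X Z (Cmp (HM \<theta> \<tau>) X Y Z h g) f"
      by (simp add: Cmp_HM compose_assoc)
  qed (auto simp: Obj_HM Idn_HM Cmp_HM intro: id comp compose_Id[OF ext] Id_compose[OF ext])
qed

lemma category_full_subcategory: "category C \<Longrightarrow> category (full_subcategory C S)"
  unfolding category_def full_subcategory_def by simp

lemma ind_object_full_subcategory: "ind_object (full_subcategory C S) P \<Longrightarrow> category C \<Longrightarrow> ind_object C P"
  unfolding ind_object_def is_functor_def full_subcategory_def by simp

section \<open>Filtered colimits of holomorphic modules\<close>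

abbreviation elt :: "('i, 'u, 'm) module_system \<Rightarrow> 'i \<Rightarrow> 'm \<Rightarrow> ('i \<times> 'm) set" where
  "elt P i s \<equiv> elt_rel P `` {(i, s)}"

lemma elt_rel_eq_diagram_rel: "elt_rel P = diagram_rel (idx P) (\<lambda>i. carrier (ob P i)) (mor P)"
  unfolding elt_rel_def diagram_rel_def elt_set_def ..

text \<open>The stages are arbitrary holomorphic modules. Projectivity is a condition on the source
  of a morphism into the colimit and enters only in the two factorisation lemmas below.\<close>

locale holomorphic_system =
  fixes \<theta> :: real and \<tau> :: complex and P :: "('i, 'u, 'm) module_system"
  assumes ind: "ind_object (HM \<theta> \<tau>) P"
begin

abbreviation A where "A \<equiv> A_theta \<theta>"

lemma ob: "i \<in> Obj (idx P) \<Longrightarrow> holomorphic_module \<theta> \<tau> (ob P i)"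
  using ind_object_ob[OF ind] by (simp add: Obj_HM)

lemma right_module_ob: "i \<in> Obj (idx P) \<Longrightarrow> right_module A (ob P i)"
  by (rule holomorphic_module_right_module[OF ob])

lemma mor: "\<lbrakk>i \<in> Obj (idx P); k \<in> Obj (idx P); u \<in> Hom (idx P) i k\<rbrakk>
    \<Longrightarrow> mor P i k u \<in> Hom (HM \<theta> \<tau>) (ob P i) (ob P k)"
  by (rule ind_object_mor[OF ind])

lemma
  assumes "i \<in> Obj (idx P)" "k \<in> Obj (idx P)" "u \<in> Hom (idx P) i k"
  shows mor_module_Hom: "mor P i k u \<in> module_Hom A (ob P i) (ob P k)"
    and mor_closed: "s \<in> carrier (ob P i) \<Longrightarrow> mor P i k u s \<in> carrier (ob P k)"
    and mor_add: "\<lbrakk>s \<in> carrier (ob P i); t \<in> carrier (ob P i)\<rbrakk>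
      \<Longrightarrow> mor P i k u (s \<oplus>\<^bsub>ob P i\<^esub> t) = mor P i k u s \<oplus>\<^bsub>ob P k\<^esub> mor P i k u t"
    and mor_act: "\<lbrakk>a \<in> carrier A; s \<in> carrier (ob P i)\<rbrakk>
      \<Longrightarrow> mor P i k u (a \<odot>\<^bsub>ob P i\<^esub> s) = a \<odot>\<^bsub>ob P k\<^esub> mor P i k u s"
    and mor_nabla: "s \<in> carrier (ob P i) \<Longrightarrow> mor P i k u (nabla (ob P i) s) = nabla (ob P k) (mor P i k u s)"
    and mor_zero: "mor P i k u \<zero>\<^bsub>ob P i\<^esub> = \<zero>\<^bsub>ob P k\<^esub>"
proof -
  have f: "mor P i k u \<in> module_Hom A (ob P i) (ob P k)"
    and n: "\<And>s. s \<in> carrier (ob P i) \<Longrightarrow> mor P i k u (nabla (ob P i) s) = nabla (ob P k) (mor P i k u s)"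
    using mor[OF assms] by (simp_all add: Hom_HM)
  show "mor P i k u \<in> module_Hom A (ob P i) (ob P k)"
    and "s \<in> carrier (ob P i) \<Longrightarrow> mor P i k u s \<in> carrier (ob P k)"
    and "\<lbrakk>s \<in> carrier (ob P i); t \<in> carrier (ob P i)\<rbrakk>
      \<Longrightarrow> mor P i k u (s \<oplus>\<^bsub>ob P i\<^esub> t) = mor P i k u s \<oplus>\<^bsub>ob P k\<^esub> mor P i k u t"
    and "\<lbrakk>a \<in> carrier A; s \<in> carrier (ob P i)\<rbrakk>
      \<Longrightarrow> mor P i k u (a \<odot>\<^bsub>ob P i\<^esub> s) = a \<odot>\<^bsub>ob P k\<^esub> mor P i k u s"
    and "s \<in> carrier (ob P i) \<Longrightarrow> mor P i k u (nabla (ob P i) s) = nabla (ob P k) (mor P i k u s)"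
    and "mor P i k u \<zero>\<^bsub>ob P i\<^esub> = \<zero>\<^bsub>ob P k\<^esub>"
    by (fact f n module_Hom_closed[OF f] module_Hom_add[OF f] module_Hom_act[OF f]
        module_Hom_zero[OF right_module_ob[OF assms(1)] right_module_ob[OF assms(2)] f])+
qed

sublocale filtered_diagram "idx P" "\<lambda>i. carrier (ob P i)" "mor P"
  rewrites "diagram_rel (idx P) (\<lambda>i. carrier (ob P i)) (mor P) = elt_rel P"
proof -
  show "filtered_diagram (idx P) (\<lambda>i. carrier (ob P i)) (mor P)"
    using ind_object_filtered[OF ind] mor_closed ind_object_mor_Idn[OF ind] ind_object_mor_Cmp[OF ind]
    by unfold_locales (simp_all add: Idn_HM Cmp_HM compose_eq)
qed (simp add: elt_rel_eq_diagram_rel)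

section \<open>Operations of the colimit evaluated at a single stage\<close>

lemma carrier_colim: "carrier (colim P) = Sigma (Obj (idx P)) (\<lambda>i. carrier (ob P i)) // elt_rel P"
  by (simp add: colim_def elt_set_def)

lemma elt_closed: "\<lbrakk>i \<in> Obj (idx P); s \<in> carrier (ob P i)\<rbrakk> \<Longrightarrow> elt P i s \<in> carrier (colim P)"
  unfolding carrier_colim by (rule cls_in_quotient)

lemma colim_cases:
  assumes "x \<in> carrier (colim P)"
  obtains i s where "i \<in> Obj (idx P)" "s \<in> carrier (ob P i)" "x = elt P i s"
  using assms unfolding carrier_colim by (rule quotient_cases) (rule that)

text \<open>The axioms to be checked involve at most three elements; at a common stage each of them
  is inherited from the module there.\<close>

lemma colim_cases3:
  assumes "x \<in> carrier (colim P)" "y \<in> carrier (colim P)" "z \<in> carrier (colim P)"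
  obtains i r s t where "i \<in> Obj (idx P)"
    "r \<in> carrier (ob P i)" "s \<in> carrier (ob P i)" "t \<in> carrier (ob P i)"
    "x = elt P i r" "y = elt P i s" "z = elt P i t"
proof -
  \<comment> \<open>The triple is packed into a family indexed by 0, 1, 2 so that
    \<open>finite_lift\<close> applies.\<close>
  let ?w = "\<lambda>a::nat. if a = 0 then x else if a = 1 then y else z"
  have "\<exists>i\<in>Obj (idx P). \<exists>w. \<forall>a<3. w a \<in> carrier (ob P i) \<and> ?w a = elt P i (w a)"
    by (rule finite_lift) (use assms carrier_colim in simp)
  then obtain i w where i: "i \<in> Obj (idx P)" and w: "\<forall>a<3. w a \<in> carrier (ob P i) \<and> ?w a = elt P i (w a)"
    by blast
  show thesis
    using that[OF i, of "w 0" "w 1" "w 2"] w[rule_format, of 0] w[rule_format, of 1] w[rule_format, of 2] by simp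
qed

lemma elt_zero: "\<lbrakk>i \<in> Obj (idx P); j \<in> Obj (idx P)\<rbrakk> \<Longrightarrow> elt P i \<zero>\<^bsub>ob P i\<^esub> = elt P j \<zero>\<^bsub>ob P j\<^esub>"
proof -
  assume i: "i \<in> Obj (idx P)" and j: "j \<in> Obj (idx P)"
  have z: "\<zero>\<^bsub>ob P i\<^esub> \<in> carrier (ob P i)" if "i \<in> Obj (idx P)" for i
  proof -
    interpret right_module A "ob P i"
      using that by (rule right_module_ob)
    show ?thesis
      by simp
  qed
  obtain k u v where k: "k \<in> Obj (idx P)" "u \<in> Hom (idx P) i k" "v \<in> Hom (idx P) j k"
    using common_stage[OF i j] by blast
  show ?thesis
    by (rule cls_eqI[of i j k _ _ u v]) (use i j k z in \<open>simp_all add: mor_zero\<close>)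
qed

lemma colim_zero: "i \<in> Obj (idx P) \<Longrightarrow> \<zero>\<^bsub>colim P\<^esub> = elt P i \<zero>\<^bsub>ob P i\<^esub>"
proof -
  assume i: "i \<in> Obj (idx P)"
  have "(\<Union>j\<in>Obj (idx P). elt P j \<zero>\<^bsub>ob P j\<^esub>) = (\<Union>j\<in>Obj (idx P). elt P i \<zero>\<^bsub>ob P i\<^esub>)"
    by (rule SUP_cong[OF refl elt_zero[OF _ i]])
  then show ?thesis
    using i by (auto simp: colim_def)
qed

text \<open>Well-definedness of the sum concerns two arguments, so \<open>UN_cls\<close> does not
  cover it. The two given equalities may be witnessed by different arrows; \<open>finite_eq\<close>
  with two pairs supplies a common one, along which the sums agree by additivity.\<close>

lemma elt_add_cong:
  assumes j: "j \<in> Obj (idx P)" and k: "k \<in> Obj (idx P)"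
    and s: "s \<in> carrier (ob P j)" "s' \<in> carrier (ob P k)" "elt P j s = elt P k s'"
    and t: "t \<in> carrier (ob P j)" "t' \<in> carrier (ob P k)" "elt P j t = elt P k t'"
  shows "elt P j (s \<oplus>\<^bsub>ob P j\<^esub> t) = elt P k (s' \<oplus>\<^bsub>ob P k\<^esub> t')"
proof -
  interpret j: right_module A "ob P j"
    using j by (rule right_module_ob)
  interpret k: right_module A "ob P k"
    using k by (rule right_module_ob)
  obtain l u v where l: "l \<in> Obj (idx P)" and u: "u \<in> Hom (idx P) j l" and v: "v \<in> Hom (idx P) k l"
    using common_stage[OF j k] by blast
  interpret l: right_module A "ob P l"
    using l by (rule right_module_ob)
  let ?S = "\<lambda>a::nat. if a = 0 then mor P j l u s else mor P j l u t"
    and ?S' = "\<lambda>a::nat. if a = 0 then mor P k l v s' else mor P k l v t'"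
  have "\<exists>m\<in>Obj (idx P). \<exists>w\<in>Hom (idx P) l m. \<forall>a<2. mor P l m w (?S a) = mor P l m w (?S' a)"
    by (rule finite_eq[OF l]) (use j k l u v s t in \<open>auto simp: mor_closed cls_T\<close>)
  then obtain m w where m: "m \<in> Obj (idx P)" and w: "w \<in> Hom (idx P) l m"
    and eq: "\<forall>a<2. mor P l m w (?S a) = mor P l m w (?S' a)"
    by blast
  have "mor P l m w (mor P j l u (s \<oplus>\<^bsub>ob P j\<^esub> t)) = mor P l m w (mor P k l v (s' \<oplus>\<^bsub>ob P k\<^esub> t'))"
    using eq[rule_format, of 0] eq[rule_format, of 1] j k l m u v w s t by (simp add: mor_closed mor_add)
  then have "elt P l (mor P j l u (s \<oplus>\<^bsub>ob P j\<^esub> t)) = elt P l (mor P k l v (s' \<oplus>\<^bsub>ob P k\<^esub> t'))"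
    by (intro cls_eqI[of l l m _ _ w w]) (use j k l m u v w s t in \<open>simp_all add: mor_closed\<close>)
  then show ?thesis
    using j k l u v s t by (simp add: cls_T)
qed

text \<open>The defining union runs over representatives of both summands and over all common later
  stages. All its members are the same class by \<open>elt_add_cong\<close>, and at least one member
  exists.\<close>

lemma colim_add:
  assumes i: "i \<in> Obj (idx P)" and s: "s \<in> carrier (ob P i)" and t: "t \<in> carrier (ob P i)"
  shows "elt P i s \<oplus>\<^bsub>colim P\<^esub> elt P i t = elt P i (s \<oplus>\<^bsub>ob P i\<^esub> t)"
proof -
  have eq: "elt P k (mor P j k u r \<oplus>\<^bsub>ob P k\<^esub> mor P j' k v r') = elt P i (s \<oplus>\<^bsub>ob P i\<^esub> t)"
    if "(j, r) \<in> elt P i s" "(j', r') \<in> elt P i t" "k \<in> Obj (idx P)" "u \<in> Hom (idx P) j k" "v \<in> Hom (idx P) j' k"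
    for j r j' r' k u v
  proof -
    have j: "j \<in> Obj (idx P)" "r \<in> carrier (ob P j)" "elt P j r = elt P i s"
      using equiv_class_eq[OF equiv_rel, of "(i, s)" "(j, r)"] that(1) by (auto simp: elt_rel_def elt_set_def)
    have j': "j' \<in> Obj (idx P)" "r' \<in> carrier (ob P j')" "elt P j' r' = elt P i t"
      using equiv_class_eq[OF equiv_rel, of "(i, t)" "(j', r')"] that(2) by (auto simp: elt_rel_def elt_set_def)
    show ?thesis
      by (rule elt_add_cong) (use that j j' i s t in \<open>simp_all add: mor_closed cls_T\<close>)
  qed
  have "(i, s) \<in> elt P i s" "(i, t) \<in> elt P i t" "Idn (idx P) i \<in> Hom (idx P) i i"
    using equiv_class_self[OF equiv_rel] category_Idn[OF cat_I] i s t by auto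
  then have "(\<Union>(j, r)\<in>elt P i s. \<Union>(j', r')\<in>elt P i t. \<Union>k\<in>Obj (idx P). \<Union>u\<in>Hom (idx P) j k. \<Union>v\<in>Hom (idx P) j' k.
      elt P k (mor P j k u r \<oplus>\<^bsub>ob P k\<^esub> mor P j' k v r')) = elt P i (s \<oplus>\<^bsub>ob P i\<^esub> t)"
    (is "?L = ?R")
  proof (intro equalityI subsetI)
    fix x assume "x \<in> ?L"
    then obtain j r j' r' k u v where "(j, r) \<in> elt P i s" "(j', r') \<in> elt P i t" "k \<in> Obj (idx P)"
      "u \<in> Hom (idx P) j k" "v \<in> Hom (idx P) j' k" "x \<in> elt P k (mor P j k u r \<oplus>\<^bsub>ob P k\<^esub> mor P j' k v r')"
      by blast
    then show "x \<in> ?R"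
      using eq by blast
  next
    fix x assume "x \<in> ?R"
    \<comment> \<open>The given representatives with common stage i and both arrows the identity
      form one admissible choice in the union.\<close>
    then have "x \<in> elt P i (mor P i i (Idn (idx P) i) s \<oplus>\<^bsub>ob P i\<^esub> mor P i i (Idn (idx P) i) t)"
      using i s t by (simp add: T_Idn)
    then show "x \<in> ?L"
      using \<open>(i, s) \<in> elt P i s\<close> \<open>(i, t) \<in> elt P i t\<close> \<open>Idn (idx P) i \<in> Hom (idx P) i i\<close> i by blast
  qed
  then show ?thesis
    by (simp add: colim_def)
qed

lemma colim_act:
  assumes a: "a \<in> carrier A" and i: "i \<in> Obj (idx P)" and s: "s \<in> carrier (ob P i)"
  shows "a \<odot>\<^bsub>colim P\<^esub> elt P i s = elt P i (a \<odot>\<^bsub>ob P i\<^esub> s)"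
proof -
  have "(\<Union>(i, s)\<in>elt P i s. elt P i (a \<odot>\<^bsub>ob P i\<^esub> s)) = elt P i (a \<odot>\<^bsub>ob P i\<^esub> s)"
  proof (rule UN_cls[OF i s])
    fix j k u t assume j: "j \<in> Obj (idx P)" "k \<in> Obj (idx P)" "u \<in> Hom (idx P) j k" and t: "t \<in> carrier (ob P j)"
    interpret j: right_module A "ob P j"
      using j(1) by (rule right_module_ob)
    show "elt P k (a \<odot>\<^bsub>ob P k\<^esub> mor P j k u t) = elt P j (a \<odot>\<^bsub>ob P j\<^esub> t)"
      using cls_T[OF j j.act_closed[OF a t]] mor_act[OF j a t] by simp
  qed
  then show ?thesis
    by (simp add: colim_def)
qed

lemma colim_nabla:
  assumes i: "i \<in> Obj (idx P)" and s: "s \<in> carrier (ob P i)"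
  shows "nabla (colim P) (elt P i s) = elt P i (nabla (ob P i) s)"
proof -
  have "(\<Union>(i, s)\<in>elt P i s. elt P i (nabla (ob P i) s)) = elt P i (nabla (ob P i) s)"
  proof (rule UN_cls[OF i s])
    fix j k u t assume j: "j \<in> Obj (idx P)" "k \<in> Obj (idx P)" "u \<in> Hom (idx P) j k" and t: "t \<in> carrier (ob P j)"
    interpret j: holomorphic_module \<theta> \<tau> "ob P j"
      using j(1) by (rule ob)
    show "elt P k (nabla (ob P k) (mor P j k u t)) = elt P j (nabla (ob P j) t)"
      using cls_T[OF j j.nabla_closed[OF t]] mor_nabla[OF j t] by simp
  qed
  then show ?thesis
    by (simp add: colim_def)
qed

lemma ob_closed:
  assumes "i \<in> Obj (idx P)"
  shows "\<zero>\<^bsub>ob P i\<^esub> \<in> carrier (ob P i)"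
    and "\<lbrakk>s \<in> carrier (ob P i); t \<in> carrier (ob P i)\<rbrakk> \<Longrightarrow> s \<oplus>\<^bsub>ob P i\<^esub> t \<in> carrier (ob P i)"
    and "\<lbrakk>a \<in> carrier A; s \<in> carrier (ob P i)\<rbrakk> \<Longrightarrow> a \<odot>\<^bsub>ob P i\<^esub> s \<in> carrier (ob P i)"
    and "s \<in> carrier (ob P i) \<Longrightarrow> nabla (ob P i) s \<in> carrier (ob P i)"
proof -
  interpret holomorphic_module \<theta> \<tau> "ob P i"
    using assms by (rule ob)
  show "\<zero>\<^bsub>ob P i\<^esub> \<in> carrier (ob P i)"
    and "\<lbrakk>s \<in> carrier (ob P i); t \<in> carrier (ob P i)\<rbrakk> \<Longrightarrow> s \<oplus>\<^bsub>ob P i\<^esub> t \<in> carrier (ob P i)"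
    and "\<lbrakk>a \<in> carrier A; s \<in> carrier (ob P i)\<rbrakk> \<Longrightarrow> a \<odot>\<^bsub>ob P i\<^esub> s \<in> carrier (ob P i)"
    and "s \<in> carrier (ob P i) \<Longrightarrow> nabla (ob P i) s \<in> carrier (ob P i)"
    by (simp_all add: act_closed nabla_closed)
qed

lemmas colim_ops = colim_zero colim_add colim_act colim_nabla elt_closed ob_closed

lemma abelian_group_colim: "abelian_group (colim P)"
proof (rule abelian_groupI)
  fix x y z assume x: "x \<in> carrier (colim P)" and y: "y \<in> carrier (colim P)" and z: "z \<in> carrier (colim P)"
  obtain i r s t where i: "i \<in> Obj (idx P)"
    and c: "r \<in> carrier (ob P i)" "s \<in> carrier (ob P i)" "t \<in> carrier (ob P i)"
    and e: "x = elt P i r" "y = elt P i s" "z = elt P i t"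
    using colim_cases3[OF x y z] by blast
  interpret holomorphic_module \<theta> \<tau> "ob P i"
    using i by (rule ob)
  show "x \<oplus>\<^bsub>colim P\<^esub> y \<oplus>\<^bsub>colim P\<^esub> z = x \<oplus>\<^bsub>colim P\<^esub> (y \<oplus>\<^bsub>colim P\<^esub> z)"
    using i c e by (simp add: colim_ops M.a_assoc)
next
  fix x y assume x: "x \<in> carrier (colim P)" and y: "y \<in> carrier (colim P)"
  obtain i r s t where i: "i \<in> Obj (idx P)"
    and c: "r \<in> carrier (ob P i)" "s \<in> carrier (ob P i)"
    and e: "x = elt P i r" "y = elt P i s"
    using colim_cases3[OF x y y] by blast
  interpret holomorphic_module \<theta> \<tau> "ob P i"
    using i by (rule ob)
  show "x \<oplus>\<^bsub>colim P\<^esub> y \<in> carrier (colim P)" "x \<oplus>\<^bsub>colim P\<^esub> y = y \<oplus>\<^bsub>colim P\<^esub> x"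
    using i c e by (simp_all add: colim_ops M.a_comm)
next
  fix x assume "x \<in> carrier (colim P)"
  then obtain i s where i: "i \<in> Obj (idx P)" "s \<in> carrier (ob P i)" "x = elt P i s"
    by (rule colim_cases)
  interpret holomorphic_module \<theta> \<tau> "ob P i"
    using i(1) by (rule ob)
  show "\<zero>\<^bsub>colim P\<^esub> \<oplus>\<^bsub>colim P\<^esub> x = x"
    \<comment> \<open>Zero has a representative at every stage; the one at the stage of x has to be
      selected explicitly.\<close>
    using i by (simp add: colim_ops(2-) colim_zero[of i])
  show "\<exists>y\<in>carrier (colim P). y \<oplus>\<^bsub>colim P\<^esub> x = \<zero>\<^bsub>colim P\<^esub>"
    using i by (intro bexI[of _ "elt P i (\<ominus>\<^bsub>ob P i\<^esub> s)"]) (simp_all add: colim_ops(2-) colim_zero[of i] M.l_neg)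
next
  obtain i where "i \<in> Obj (idx P)"
    using filtered by (auto simp: filtered_category_def)
  then show "\<zero>\<^bsub>colim P\<^esub> \<in> carrier (colim P)"
    by (simp add: colim_ops(2-) colim_zero[of i])
qed

lemma right_module_colim: "right_module A (colim P)"
proof (intro right_module.intro right_module_axioms.intro)
  fix x y a b assume x: "x \<in> carrier (colim P)" and y: "y \<in> carrier (colim P)"
    and a: "a \<in> carrier A" and b: "b \<in> carrier A"
  obtain i s t where i: "i \<in> Obj (idx P)"
    and c: "s \<in> carrier (ob P i)" "t \<in> carrier (ob P i)"
    and e: "x = elt P i s" "y = elt P i t"
    using colim_cases3[OF x y y] by blast
  interpret holomorphic_module \<theta> \<tau> "ob P i"
    using i by (rule ob)
  show "a \<odot>\<^bsub>colim P\<^esub> (x \<oplus>\<^bsub>colim P\<^esub> y) = a \<odot>\<^bsub>colim P\<^esub> x \<oplus>\<^bsub>colim P\<^esub> a \<odot>\<^bsub>colim P\<^esub> y"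
    using i c e a by (simp add: colim_ops act_add)
next
  fix x a b assume x: "x \<in> carrier (colim P)" and a: "a \<in> carrier A" and b: "b \<in> carrier A"
  obtain i s where i: "i \<in> Obj (idx P)" "s \<in> carrier (ob P i)" "x = elt P i s"
    using colim_cases[OF x] by blast
  interpret holomorphic_module \<theta> \<tau> "ob P i"
    using i(1) by (rule ob)
  show "(a \<oplus>\<^bsub>A\<^esub> b) \<odot>\<^bsub>colim P\<^esub> x = a \<odot>\<^bsub>colim P\<^esub> x \<oplus>\<^bsub>colim P\<^esub> b \<odot>\<^bsub>colim P\<^esub> x"
    and "(a \<otimes>\<^bsub>A\<^esub> b) \<odot>\<^bsub>colim P\<^esub> x = b \<odot>\<^bsub>colim P\<^esub> (a \<odot>\<^bsub>colim P\<^esub> x)"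
    using i a b by (simp_all add: colim_ops act_add_scalar act_assoc)
next
  fix x a assume x: "x \<in> carrier (colim P)" and a: "a \<in> carrier A"
  obtain i s where i: "i \<in> Obj (idx P)" "s \<in> carrier (ob P i)" "x = elt P i s"
    using colim_cases[OF x] by blast
  then show "a \<odot>\<^bsub>colim P\<^esub> x \<in> carrier (colim P)"
    using a by (simp add: colim_ops)
next
  fix x assume x: "x \<in> carrier (colim P)"
  obtain i s where i: "i \<in> Obj (idx P)" "s \<in> carrier (ob P i)" "x = elt P i s"
    using colim_cases[OF x] by blast
  interpret holomorphic_module \<theta> \<tau> "ob P i"
    using i(1) by (rule ob)
  show "\<one>\<^bsub>A\<^esub> \<odot>\<^bsub>colim P\<^esub> x = x"
    using i by (simp add: colim_ops act_one)
qed (simp_all add: ring_A_theta abelian_group_colim)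

lemma holomorphic_module_colim: "holomorphic_module \<theta> \<tau> (colim P)"
proof (intro holomorphic_module.intro holomorphic_module_axioms.intro)
  fix x y assume x: "x \<in> carrier (colim P)" and y: "y \<in> carrier (colim P)"
  obtain i s t where i: "i \<in> Obj (idx P)"
    and c: "s \<in> carrier (ob P i)" "t \<in> carrier (ob P i)"
    and e: "x = elt P i s" "y = elt P i t"
    using colim_cases3[OF x y y] by blast
  interpret holomorphic_module \<theta> \<tau> "ob P i"
    using i by (rule ob)
  show "nabla (colim P) (x \<oplus>\<^bsub>colim P\<^esub> y) = nabla (colim P) x \<oplus>\<^bsub>colim P\<^esub> nabla (colim P) y"
    using i c e by (simp add: colim_ops nabla_add)
next
  fix x a assume x: "x \<in> carrier (colim P)" and a: "a \<in> carrier A"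
  obtain i s where i: "i \<in> Obj (idx P)" "s \<in> carrier (ob P i)" "x = elt P i s"
    using colim_cases[OF x] by blast
  interpret holomorphic_module \<theta> \<tau> "ob P i"
    using i(1) by (rule ob)
  show "nabla (colim P) (a \<odot>\<^bsub>colim P\<^esub> x) =
      a \<odot>\<^bsub>colim P\<^esub> nabla (colim P) x \<oplus>\<^bsub>colim P\<^esub> delta \<tau> a \<odot>\<^bsub>colim P\<^esub> x"
    using i a by (simp add: colim_ops nabla_Leibniz delta_closed)
next
  fix x c assume x: "x \<in> carrier (colim P)"
  obtain i s where i: "i \<in> Obj (idx P)" "s \<in> carrier (ob P i)" "x = elt P i s"
    using colim_cases[OF x] by blast
  interpret holomorphic_module \<theta> \<tau> "ob P i"
    using i(1) by (rule ob)
  show "nabla (colim P) x \<in> carrier (colim P)"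
    and "nabla (colim P) (nct_scalar c \<odot>\<^bsub>colim P\<^esub> x) = nct_scalar c \<odot>\<^bsub>colim P\<^esub> nabla (colim P) x"
    using i by (simp_all add: colim_ops nabla_scalar nct_scalar_closed)
qed (rule right_module_colim)

text \<open>The canonical map of a stage into the colimit, restricted to the carrier because
  elements of \<open>module_Hom\<close> must be extensional.\<close>

definition coproj :: "'i \<Rightarrow> 'm \<Rightarrow> ('i \<times> 'm) set" where
  "coproj i = (\<lambda>s\<in>carrier (ob P i). elt P i s)"

lemma coproj_eq: "s \<in> carrier (ob P i) \<Longrightarrow> coproj i s = elt P i s"
  by (simp add: coproj_def)

lemma coproj_module_Hom: "i \<in> Obj (idx P) \<Longrightarrow> coproj i \<in> module_Hom A (ob P i) (colim P)"
  by (simp add: module_Hom_def coproj_def colim_ops)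

section \<open>Compactness of finitely generated projective modules with connection\<close>

text \<open>The two maps may land at different stages. They are moved to a common stage l, where
  \<open>finite_eq\<close> finds one arrow identifying their values on all generators; linearity
  extends the equality to M.\<close>

lemma fin_gen_projective_Hom_eq:
  assumes M: "right_module A M" and fgp: "fin_gen_projective A M"
    and j: "j \<in> Obj (idx P)" and j': "j' \<in> Obj (idx P)"
    and f: "f \<in> module_Hom A M (ob P j)" and f': "f' \<in> module_Hom A M (ob P j')"
    and eq: "\<And>s. s \<in> carrier M \<Longrightarrow> elt P j (f s) = elt P j' (f' s)"
  obtains k u v where "k \<in> Obj (idx P)" "u \<in> Hom (idx P) j k" "v \<in> Hom (idx P) j' k"
    "compose (carrier M) (mor P j k u) f = compose (carrier M) (mor P j' k v) f'"
proof -
  obtain n m e where m: "\<And>k. k < n \<Longrightarrow> m k \<in> carrier M"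
    and e: "\<And>s k. \<lbrakk>s \<in> carrier M; k < n\<rbrakk> \<Longrightarrow> e s k \<in> carrier A"
    and lc: "\<And>s. s \<in> carrier M \<Longrightarrow> lincomb M m (e s) n = s"
    using fin_gen_projective_dual_basis[OF M fgp] by metis
  obtain l u v where l: "l \<in> Obj (idx P)" and u: "u \<in> Hom (idx P) j l" and v: "v \<in> Hom (idx P) j' l"
    using common_stage[OF j j'] by blast
  have "\<exists>k\<in>Obj (idx P). \<exists>w\<in>Hom (idx P) l k. \<forall>a<n.
      mor P l k w (mor P j l u (f (m a))) = mor P l k w (mor P j' l v (f' (m a)))"
    by (rule finite_eq[OF l])
      (use j j' l u v m f f' eq in \<open>simp add: mor_closed cls_T module_Hom_closed\<close>)
  then obtain k w where k: "k \<in> Obj (idx P)" and w: "w \<in> Hom (idx P) l k"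
    and meq: "\<And>a. a < n \<Longrightarrow> mor P l k w (mor P j l u (f (m a))) = mor P l k w (mor P j' l v (f' (m a)))"
    by blast
  define U where "U = Cmp (idx P) j l k w u"
  define V where "V = Cmp (idx P) j' l k w v"
  have U: "U \<in> Hom (idx P) j k" and V: "V \<in> Hom (idx P) j' k"
    unfolding U_def V_def using category_Cmp[OF cat_I] j j' l k u v w by auto
  note F = module_Hom_compose[OF M f mor_module_Hom[OF j k U]]
    and F' = module_Hom_compose[OF M f' mor_module_Hom[OF j' k V]]
  have "compose (carrier M) (mor P j k U) f s = compose (carrier M) (mor P j' k V) f' s" if s: "s \<in> carrier M" for s
  proof -
    have "lincomb (ob P k) (\<lambda>a. compose (carrier M) (mor P j k U) f (m a)) (e s) n =
        lincomb (ob P k) (\<lambda>a. compose (carrier M) (mor P j' k V) f' (m a)) (e s) n"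
      by (rule lincomb_cong)
        (use m meq j j' l k u v w f f' in \<open>simp_all add: compose_eq U_def V_def T_Cmp module_Hom_closed\<close>)
    then show ?thesis
      using module_Hom_lincomb[OF M right_module_ob[OF k] F, of n m "e s"]
        module_Hom_lincomb[OF M right_module_ob[OF k] F', of n m "e s"] m e[OF s] lc[OF s] by simp
  qed
  then have "compose (carrier M) (mor P j k U) f = compose (carrier M) (mor P j' k V) f'"
    by (intro extensionalityI[of _ "carrier M"]) simp_all
  then show thesis
    using that[OF k U V] by blast
qed

text \<open>Existence of a factorisation takes two passages: one to a stage i that admits a linear
  lift \<open>h\<close>, and one to a later stage j where the lift commutes with the
  connections.\<close>

lemma fin_gen_projective_lift:
  assumes M: "holomorphic_module \<theta> \<tau> M" and fgp: "fin_gen_projective A M"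
    and g: "g \<in> module_Hom A M (colim P)"
    and g_nabla: "\<And>s. s \<in> carrier M \<Longrightarrow> g (nabla M s) = nabla (colim P) (g s)"
  obtains j f where "j \<in> Obj (idx P)" "f \<in> Hom (HM \<theta> \<tau>) M (ob P j)"
    "\<And>s. s \<in> carrier M \<Longrightarrow> g s = elt P j (f s)"
proof -
  interpret M: holomorphic_module \<theta> \<tau> M by fact
  note rM = holomorphic_module_right_module[OF M]
  obtain n m e where m: "\<And>k. k < n \<Longrightarrow> m k \<in> carrier M"
    and e: "\<And>s k. \<lbrakk>s \<in> carrier M; k < n\<rbrakk> \<Longrightarrow> e s k \<in> carrier A"
    and e_add: "\<And>s t k. \<lbrakk>s \<in> carrier M; t \<in> carrier M; k < n\<rbrakk> \<Longrightarrow> e (s \<oplus>\<^bsub>M\<^esub> t) k = e s k \<oplus>\<^bsub>A\<^esub> e t k"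
    and e_act: "\<And>a s k. \<lbrakk>a \<in> carrier A; s \<in> carrier M; k < n\<rbrakk> \<Longrightarrow> e (a \<odot>\<^bsub>M\<^esub> s) k = e s k \<otimes>\<^bsub>A\<^esub> a"
    and lc: "\<And>s. s \<in> carrier M \<Longrightarrow> lincomb M m (e s) n = s"
    using fin_gen_projective_dual_basis[OF rM fgp] by blast
  obtain i q where i: "i \<in> Obj (idx P)" and q: "\<And>a. a < n \<Longrightarrow> q a \<in> carrier (ob P i)"
    and gq: "\<And>a. a < n \<Longrightarrow> g (m a) = elt P i (q a)"
    using finite_lift[of n "\<lambda>a. g (m a)"] module_Hom_closed[OF g m] carrier_colim by blast
  interpret Pi: holomorphic_module \<theta> \<tau> "ob P i"
    using i by (rule ob)
  \<comment> \<open>Linear because the coordinates are, for any lifts \<open>q\<close>. The value of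
    \<open>h\<close> at \<open>m k\<close> need not be \<open>q k\<close>; only their classes in the
    colimit agree.\<close>
  define h where "h = (\<lambda>s\<in>carrier M. lincomb (ob P i) q (e s) n)"
  have h: "h \<in> module_Hom A M (ob P i)"
  proof -
    have "lincomb (ob P i) q (e (s \<oplus>\<^bsub>M\<^esub> t)) n = lincomb (ob P i) q (e s) n \<oplus>\<^bsub>ob P i\<^esub> lincomb (ob P i) q (e t) n"
      if "s \<in> carrier M" "t \<in> carrier M" for s t
    proof -
      have "lincomb (ob P i) q (e (s \<oplus>\<^bsub>M\<^esub> t)) n = lincomb (ob P i) q (\<lambda>k. e s k \<oplus>\<^bsub>A\<^esub> e t k) n"
        by (rule lincomb_cong) (simp_all add: e_add that)
      then show ?thesis
        using Pi.lincomb_add[of n q "e s" "e t"] q e that by simp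
    qed
    moreover have "lincomb (ob P i) q (e (a \<odot>\<^bsub>M\<^esub> s)) n = a \<odot>\<^bsub>ob P i\<^esub> lincomb (ob P i) q (e s) n"
      if "a \<in> carrier A" "s \<in> carrier M" for a s
    proof -
      have "lincomb (ob P i) q (e (a \<odot>\<^bsub>M\<^esub> s)) n = lincomb (ob P i) q (\<lambda>k. e s k \<otimes>\<^bsub>A\<^esub> a) n"
        by (rule lincomb_cong) (simp_all add: e_act that)
      then show ?thesis
        using Pi.lincomb_act[of n q "e s" a] q e that by simp
    qed
    ultimately show ?thesis
      using q e by (simp add: module_Hom_def h_def M.act_closed Pi.lincomb_closed)
  qed
  \<comment> \<open>Both sides are the same combination of the \<open>g (m k)\<close> with
    coefficients \<open>e s k\<close>: on the left through linearity of \<open>coproj i\<close>, on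
    the right through the dual basis expansion of s.\<close>
  have gh: "g s = elt P i (h s)" if s: "s \<in> carrier M" for s
  proof -
    have "coproj i (h s) = lincomb (colim P) (\<lambda>a. coproj i (q a)) (e s) n"
      using module_Hom_lincomb[OF right_module_ob[OF i] right_module_colim coproj_module_Hom[OF i], of n q "e s"]
        q e s by (simp add: h_def)
    also have "\<dots> = lincomb (colim P) (\<lambda>a. g (m a)) (e s) n"
      by (rule lincomb_cong) (simp_all add: coproj_eq q gq)
    also have "\<dots> = g s"
      using module_Hom_lincomb[OF rM right_module_colim g, of n m "e s"] m e s lc by simp
    finally show ?thesis
      using module_Hom_closed[OF h s] by (simp add: coproj_eq)
  qed
  \<comment> \<open>For each generator both elements represent \<open>g (nabla M (m a))\<close>,
    because g commutes with the connections. Finitely many such equalities hold at a later stage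
    j.\<close>
  have "\<exists>j\<in>Obj (idx P). \<exists>w\<in>Hom (idx P) i j. \<forall>a<n.
      mor P i j w (h (nabla M (m a))) = mor P i j w (nabla (ob P i) (h (m a)))"
  proof (rule finite_eq[OF i], intro conjI)
    fix a assume a: "a < n"
    show "elt P i (h (nabla M (m a))) = elt P i (nabla (ob P i) (h (m a)))"
      using gh[OF M.nabla_closed[OF m[OF a]]] gh[OF m[OF a]] g_nabla[OF m[OF a]]
        colim_nabla[OF i module_Hom_closed[OF h m[OF a]]] by simp
  qed (use m h in \<open>simp_all add: module_Hom_closed M.nabla_closed Pi.nabla_closed\<close>)
  then obtain j w where j: "j \<in> Obj (idx P)" and w: "w \<in> Hom (idx P) i j"
    and meq: "\<And>a. a < n \<Longrightarrow> mor P i j w (h (nabla M (m a))) = mor P i j w (nabla (ob P i) (h (m a)))"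
    by blast
  interpret Pj: holomorphic_module \<theta> \<tau> "ob P j"
    using j by (rule ob)
  define f where "f = compose (carrier M) (mor P i j w) h"
  have f: "f \<in> module_Hom A M (ob P j)"
    unfolding f_def using rM h mor_module_Hom[OF i j w] by (rule module_Hom_compose)
  note f_simps = module_Hom_closed[OF f] module_Hom_add[OF f] module_Hom_act[OF f]
  \<comment> \<open>The defect is not formed as a map; its linearity is used through partial sums.
    Applying the Leibniz rule in M and in the target produces the same term with
    \<open>delta \<tau> (v k)\<close>, so commutation on \<open>m k\<close> passes to
    \<open>m k\<close> times \<open>v k\<close>.\<close>
  have f_lincomb: "f (nabla M (lincomb M m v k)) = nabla (ob P j) (f (lincomb M m v k))"
    if "k \<le> n" "\<And>a. a < n \<Longrightarrow> v a \<in> carrier A" for v k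
    using that(1)
  proof (induction k)
    case 0
    have "nabla M \<zero>\<^bsub>M\<^esub> = \<zero>\<^bsub>M\<^esub>" "nabla (ob P j) \<zero>\<^bsub>ob P j\<^esub> = \<zero>\<^bsub>ob P j\<^esub>"
      using M.nabla_add[of "\<zero>\<^bsub>M\<^esub>" "\<zero>\<^bsub>M\<^esub>"] Pj.nabla_add[of "\<zero>\<^bsub>ob P j\<^esub>" "\<zero>\<^bsub>ob P j\<^esub>"]
      by (auto intro!: M.eq_zero_if_add_self Pj.eq_zero_if_add_self simp: M.nabla_closed Pj.nabla_closed)
    then show ?case
      by (simp add: module_Hom_zero[OF rM right_module_ob[OF j] f])
  next
    case (Suc k)
    have k: "k < n" "v k \<in> carrier A" "m k \<in> carrier M"
      using Suc.prems that m by auto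
    have c: "lincomb M m v k \<in> carrier M"
      using Suc.prems that(2) m by (intro M.lincomb_closed) simp_all
    have "f (nabla M (m k)) = nabla (ob P j) (f (m k))"
      using meq[OF k(1)] k(3) mor_nabla[OF i j w] h
      by (simp add: f_def compose_eq M.nabla_closed module_Hom_closed)
    then show ?case
      using Suc k c by (simp add: M.nabla_add M.nabla_Leibniz M.act_closed M.nabla_closed delta_closed
          Pj.nabla_add Pj.nabla_Leibniz Pj.act_closed f_simps)
  qed
  show thesis
  proof (rule that[OF j])
    show "f \<in> Hom (HM \<theta> \<tau>) M (ob P j)"
      \<comment> \<open>With coefficients \<open>e s\<close> and all n terms the linear combination
        is s itself.\<close>
      using f f_lincomb[of n] e lc by (metis Hom_HM order_refl)
    show "g s = elt P j (f s)" if "s \<in> carrier M" for s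
      using gh[OF that] that i j w module_Hom_closed[OF h that] by (simp add: f_def compose_eq cls_T)
  qed
qed

end

section \<open>The natural functor\<close>

lemma Obj_Vect: "M \<in> Obj (Vect \<theta> \<tau>) \<longleftrightarrow> holomorphic_module \<theta> \<tau> M \<and> fin_gen_projective (A_theta \<theta>) M"
  by (simp add: Vect_def full_subcategory_def Obj_HM)

lemma Hom_Vect: "Hom (Vect \<theta> \<tau>) = Hom (HM \<theta> \<tau>)"
  by (simp add: Vect_def full_subcategory_def)

lemma Idn_Vect: "Idn (Vect \<theta> \<tau>) M = (\<lambda>s\<in>carrier M. s)"
  by (simp add: Vect_def full_subcategory_def Idn_HM)

lemma Cmp_Vect: "Cmp (Vect \<theta> \<tau>) L M N g f = compose (carrier L) g f"
  by (simp add: Vect_def full_subcategory_def Cmp_HM)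

lemma category_Vect: "category (Vect \<theta> \<tau>)"
  unfolding Vect_def by (rule category_full_subcategory[OF category_HM])

lemma holomorphic_system_Vect: "ind_object (Vect \<theta> \<tau>) P \<Longrightarrow> holomorphic_system \<theta> \<tau> P"
  unfolding Vect_def
  by (rule holomorphic_system.intro) (rule ind_object_full_subcategory[OF _ category_HM])

lemma Hom_HM_closed: "\<lbrakk>f \<in> Hom (HM \<theta> \<tau>) M N; s \<in> carrier M\<rbrakk> \<Longrightarrow> f s \<in> carrier N"
  unfolding Hom_HM by (blast intro: module_Hom_closed)

lemma Hom_HM_extensional: "f \<in> Hom (HM \<theta> \<tau>) M N \<Longrightarrow> f \<in> extensional (carrier M)"
  unfolding Hom_HM by (blast intro: module_Hom_extensional)

section \<open>Functoriality of the passage to the colimit\<close>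

text \<open>Evaluates the two nested unions in the definition of \<open>colim_map\<close> on chosen
  representatives; all later computations with \<open>colim_map\<close> go through this
  formula.\<close>

lemma colim_map_elt:
  fixes P Q :: "('i, 'u, 'm) module_system"
  assumes P: "ind_object (Vect \<theta> \<tau>) P" and Q: "ind_object (Vect \<theta> \<tau>) Q"
    and \<phi>: "\<phi> \<in> ind_Hom (Vect \<theta> \<tau>) P Q"
    and i: "i \<in> Obj (idx P)" and s: "s \<in> carrier (ob P i)"
    and j: "j \<in> Obj (idx Q)" and f: "f \<in> Hom (HM \<theta> \<tau>) (ob P i) (ob Q j)"
    and \<phi>i: "\<phi> i = germ (Vect \<theta> \<tau>) Q (ob P i) j f"
  shows "colim_map P Q \<phi> (elt P i s) = elt Q j (f s)"
proof -
  interpret P: holomorphic_system \<theta> \<tau> P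
    using P by (rule holomorphic_system_Vect)
  interpret Q: holomorphic_system \<theta> \<tau> Q
    using Q by (rule holomorphic_system_Vect)
  \<comment> \<open>Stated for arbitrary i, s, j, f because the outer union compares its value at
    both ends of a transition map of P.\<close>
  have inner: "(\<Union>(j, f)\<in>\<phi> i. elt Q j (f s)) = elt Q j (f s)"
    if i: "i \<in> Obj (idx P)" and s: "s \<in> carrier (ob P i)"
      and j: "j \<in> Obj (idx Q)" and f: "f \<in> Hom (Vect \<theta> \<tau>) (ob P i) (ob Q j)"
      and \<phi>i: "\<phi> i = germ (Vect \<theta> \<tau>) Q (ob P i) j f" for i s j f
    unfolding \<phi>i
  proof (rule germs.UN_germ[OF germsI[OF Q ind_object_ob[OF P i]] j f])
    fix l k u h assume "l \<in> Obj (idx Q)" "k \<in> Obj (idx Q)" "u \<in> Hom (idx Q) l k"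
      and "h \<in> Hom (Vect \<theta> \<tau>) (ob P i) (ob Q l)"
    then show "elt Q k (Cmp (Vect \<theta> \<tau>) (ob P i) (ob Q l) (ob Q k) (mor Q l k u) h s) = elt Q l (h s)"
      using s by (simp add: Cmp_Vect Hom_Vect compose_eq Q.cls_T Hom_HM_closed)
  qed
  have "(\<Union>(i, s)\<in>elt P i s. \<Union>(j, f)\<in>\<phi> i. elt Q j (f s)) = (\<Union>(j, f)\<in>\<phi> i. elt Q j (f s))"
  proof (rule P.UN_cls[OF i s])
    fix i i' u s assume i: "i \<in> Obj (idx P)" and i': "i' \<in> Obj (idx P)" and u: "u \<in> Hom (idx P) i i'"
      and s: "s \<in> carrier (ob P i)"
    obtain j f where j: "j \<in> Obj (idx Q)" and f: "f \<in> Hom (Vect \<theta> \<tau>) (ob P i') (ob Q j)"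
      and \<phi>i': "\<phi> i' = germ (Vect \<theta> \<tau>) Q (ob P i') j f"
      using ind_Hom_cases[OF P Q \<phi> i'] by blast
    let ?f = "Cmp (Vect \<theta> \<tau>) (ob P i) (ob P i') (ob Q j) f (mor P i i' u)"
    have f': "?f \<in> Hom (Vect \<theta> \<tau>) (ob P i) (ob Q j)"
      by (rule category_Cmp[OF category_Vect ind_object_ob[OF P i] ind_object_ob[OF P i']
            ind_object_ob[OF Q j] ind_object_mor[OF P i i' u] f])
    show "(\<Union>(j, f)\<in>\<phi> i'. elt Q j (f (mor P i i' u s))) = (\<Union>(j, f)\<in>\<phi> i. elt Q j (f s))"
      unfolding inner[OF i' P.mor_closed[OF i i' u s] j f \<phi>i']
        inner[OF i s j f' ind_Hom_mor[OF P Q \<phi> i i' u j f \<phi>i']]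
      using s by (simp add: Cmp_Vect compose_eq)
  qed
  also have "\<dots> = elt Q j (f s)"
    using inner[OF i s j _ \<phi>i] f by (simp add: Hom_Vect)
  finally show ?thesis
    using P.elt_closed[OF i s] by (simp add: colim_map_def)
qed

lemma colim_map_in_Hom:
  fixes P Q :: "('i, 'u, 'm) module_system"
  assumes P: "ind_object (Vect \<theta> \<tau>) P" and Q: "ind_object (Vect \<theta> \<tau>) Q"
    and \<phi>: "\<phi> \<in> ind_Hom (Vect \<theta> \<tau>) P Q"
  shows "colim_map P Q \<phi> \<in> Hom (HM \<theta> \<tau>) (colim P) (colim Q)"
proof -
  interpret P: holomorphic_system \<theta> \<tau> P
    using P by (rule holomorphic_system_Vect)
  interpret Q: holomorphic_system \<theta> \<tau> Q
    using Q by (rule holomorphic_system_Vect)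
  \<comment> \<open>One f serves all s at the stage i. This is what makes additivity work: two
    summands at a common stage are mapped by the same homomorphism.\<close>
  have rep: "\<exists>j f. j \<in> Obj (idx Q) \<and> f \<in> Hom (HM \<theta> \<tau>) (ob P i) (ob Q j) \<and>
      (\<forall>s\<in>carrier (ob P i). colim_map P Q \<phi> (elt P i s) = elt Q j (f s))" if i: "i \<in> Obj (idx P)" for i
    using ind_Hom_cases[OF P Q \<phi> i] colim_map_elt[OF P Q \<phi> i] unfolding Hom_Vect by metis
  have closed: "colim_map P Q \<phi> x \<in> carrier (colim Q)"
    and nabla: "colim_map P Q \<phi> (nabla (colim P) x) = nabla (colim Q) (colim_map P Q \<phi> x)"
    and act: "a \<in> carrier (A_theta \<theta>) \<Longrightarrow>
      colim_map P Q \<phi> (a \<odot>\<^bsub>colim P\<^esub> x) = a \<odot>\<^bsub>colim Q\<^esub> colim_map P Q \<phi> x"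
    and add: "y \<in> carrier (colim P) \<Longrightarrow>
      colim_map P Q \<phi> (x \<oplus>\<^bsub>colim P\<^esub> y) = colim_map P Q \<phi> x \<oplus>\<^bsub>colim Q\<^esub> colim_map P Q \<phi> y"
    if x: "x \<in> carrier (colim P)" for x y a
  proof -
    obtain i s where i: "i \<in> Obj (idx P)" "s \<in> carrier (ob P i)" "x = elt P i s"
      using P.colim_cases[OF x] by blast
    obtain j f where j: "j \<in> Obj (idx Q)" and f: "f \<in> Hom (HM \<theta> \<tau>) (ob P i) (ob Q j)"
      and map: "\<And>s. s \<in> carrier (ob P i) \<Longrightarrow> colim_map P Q \<phi> (elt P i s) = elt Q j (f s)"
      using rep[OF i(1)] by blast
    note fm = f[unfolded Hom_HM, THEN conjunct1]
    show "colim_map P Q \<phi> x \<in> carrier (colim Q)"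
      and "colim_map P Q \<phi> (nabla (colim P) x) = nabla (colim Q) (colim_map P Q \<phi> x)"
      and "a \<in> carrier (A_theta \<theta>) \<Longrightarrow>
        colim_map P Q \<phi> (a \<odot>\<^bsub>colim P\<^esub> x) = a \<odot>\<^bsub>colim Q\<^esub> colim_map P Q \<phi> x"
      using i j f by (simp_all add: map P.colim_ops Q.colim_ops Hom_HM module_Hom_closed[OF fm] module_Hom_act[OF fm])
  next
    assume y: "y \<in> carrier (colim P)"
    obtain i s t where i: "i \<in> Obj (idx P)" "s \<in> carrier (ob P i)" "t \<in> carrier (ob P i)"
      "x = elt P i s" "y = elt P i t"
      using P.colim_cases3[OF x y y] by blast
    obtain j f where j: "j \<in> Obj (idx Q)" and f: "f \<in> Hom (HM \<theta> \<tau>) (ob P i) (ob Q j)"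
      and map: "\<And>s. s \<in> carrier (ob P i) \<Longrightarrow> colim_map P Q \<phi> (elt P i s) = elt Q j (f s)"
      using rep[OF i(1)] by blast
    note fm = f[unfolded Hom_HM, THEN conjunct1]
    show "colim_map P Q \<phi> (x \<oplus>\<^bsub>colim P\<^esub> y) = colim_map P Q \<phi> x \<oplus>\<^bsub>colim Q\<^esub> colim_map P Q \<phi> y"
      using i j by (simp add: map P.colim_ops Q.colim_ops module_Hom_closed[OF fm] module_Hom_add[OF fm])
  qed
  have "colim_map P Q \<phi> \<in> extensional (carrier (colim P))"
    by (simp add: colim_map_def)
  then show ?thesis
    using closed nabla act add by (simp add: Hom_HM module_Hom_def PiE_def)
qed

lemma colim_map_Idn:
  fixes P :: "('i, 'u, 'm) module_system"
  assumes P: "ind_object (Vect \<theta> \<tau>) P"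
  shows "colim_map P P (ind_Idn (Vect \<theta> \<tau>) P) = (\<lambda>x\<in>carrier (colim P). x)"
proof (rule extensionalityI)
  interpret P: holomorphic_system \<theta> \<tau> P
    using P by (rule holomorphic_system_Vect)
  fix x assume x: "x \<in> carrier (colim P)"
  then obtain i s where i: "i \<in> Obj (idx P)" "s \<in> carrier (ob P i)" "x = elt P i s"
    by (rule P.colim_cases)
  have "Idn (Vect \<theta> \<tau>) (ob P i) \<in> Hom (HM \<theta> \<tau>) (ob P i) (ob P i)"
    using category_Idn[OF category_Vect ind_object_ob[OF P i(1)]] by (simp only: Hom_Vect)
  then have "colim_map P P (ind_Idn (Vect \<theta> \<tau>) P) (elt P i s) = elt P i (Idn (Vect \<theta> \<tau>) (ob P i) s)"
    by (rule colim_map_elt[OF P P ind_Idn_in_ind_Hom[OF P] i(1,2,1)]) (simp add: ind_Idn_def i(1))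
  then show "colim_map P P (ind_Idn (Vect \<theta> \<tau>) P) x = (\<lambda>x\<in>carrier (colim P). x) x"
    using i x by (simp add: Idn_Vect)
qed (simp_all add: colim_map_def)

lemma colim_map_Cmp:
  fixes P Q R :: "('i, 'u, 'm) module_system"
  assumes P: "ind_object (Vect \<theta> \<tau>) P" and Q: "ind_object (Vect \<theta> \<tau>) Q" and R: "ind_object (Vect \<theta> \<tau>) R"
    and \<phi>: "\<phi> \<in> ind_Hom (Vect \<theta> \<tau>) P Q" and \<psi>: "\<psi> \<in> ind_Hom (Vect \<theta> \<tau>) Q R"
  shows "colim_map P R (ind_Cmp (Vect \<theta> \<tau>) P Q R \<psi> \<phi>) =
    compose (carrier (colim P)) (colim_map Q R \<psi>) (colim_map P Q \<phi>)"
proof (rule extensionalityI)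
  interpret P: holomorphic_system \<theta> \<tau> P
    using P by (rule holomorphic_system_Vect)
  fix x assume x: "x \<in> carrier (colim P)"
  then obtain i s where i: "i \<in> Obj (idx P)" and s: "s \<in> carrier (ob P i)" and x_eq: "x = elt P i s"
    by (rule P.colim_cases)
  obtain j f k g where j: "j \<in> Obj (idx Q)" "f \<in> Hom (Vect \<theta> \<tau>) (ob P i) (ob Q j)" "\<phi> i = germ (Vect \<theta> \<tau>) Q (ob P i) j f"
    and k: "k \<in> Obj (idx R)" "g \<in> Hom (Vect \<theta> \<tau>) (ob Q j) (ob R k)" "\<psi> j = germ (Vect \<theta> \<tau>) R (ob Q j) k g"
    and c: "ind_Cmp (Vect \<theta> \<tau>) P Q R \<psi> \<phi> i =
      germ (Vect \<theta> \<tau>) R (ob P i) k (Cmp (Vect \<theta> \<tau>) (ob P i) (ob Q j) (ob R k) g f)"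
    using ind_Cmp_cases[OF P Q R \<phi> \<psi> i] by blast
  have gf: "Cmp (Vect \<theta> \<tau>) (ob P i) (ob Q j) (ob R k) g f \<in> Hom (Vect \<theta> \<tau>) (ob P i) (ob R k)"
    by (rule category_Cmp[OF category_Vect ind_object_ob[OF P i] ind_object_ob[OF Q j(1)] ind_object_ob[OF R k(1)] j(2) k(2)])
  have "colim_map P R (ind_Cmp (Vect \<theta> \<tau>) P Q R \<psi> \<phi>) (elt P i s) = elt R k (g (f s))"
    using colim_map_elt[OF P R ind_Cmp_in_ind_Hom[OF P Q R \<phi> \<psi>] i s k(1) gf[unfolded Hom_Vect] c] s
    by (simp add: Cmp_Vect compose_eq)
  also have "\<dots> = colim_map Q R \<psi> (colim_map P Q \<phi> (elt P i s))"
    using colim_map_elt[OF P Q \<phi> i s j(1) _ j(3)] colim_map_elt[OF Q R \<psi> j(1) _ k(1) _ k(3), of "f s"] j k s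
    by (simp add: Hom_Vect Hom_HM_closed)
  finally show "colim_map P R (ind_Cmp (Vect \<theta> \<tau>) P Q R \<psi> \<phi>) x =
      compose (carrier (colim P)) (colim_map Q R \<psi>) (colim_map P Q \<phi>) x"
    using x by (simp add: x_eq compose_eq)
qed (simp_all add: colim_map_def)

section \<open>Faithfulness and fullness\<close>

text \<open>The uniqueness half of compactness in terms of germs. It gives injectivity on morphisms
  and also the compatibility of the family built for surjectivity.\<close>

lemma Vect_germ_eqI:
  fixes Q :: "('i, 'u, 'm) module_system"
  assumes M: "M \<in> Obj (Vect \<theta> \<tau>)" and Q: "ind_object (Vect \<theta> \<tau>) Q"
    and j: "j \<in> Obj (idx Q)" and j': "j' \<in> Obj (idx Q)"
    and f: "f \<in> Hom (HM \<theta> \<tau>) M (ob Q j)" and f': "f' \<in> Hom (HM \<theta> \<tau>) M (ob Q j')"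
    and eq: "\<And>s. s \<in> carrier M \<Longrightarrow> elt Q j (f s) = elt Q j' (f' s)"
  shows "germ (Vect \<theta> \<tau>) Q M j f = germ (Vect \<theta> \<tau>) Q M j' f'"
proof -
  interpret Q: holomorphic_system \<theta> \<tau> Q
    using Q by (rule holomorphic_system_Vect)
  have rM: "right_module (A_theta \<theta>) M" and fgp: "fin_gen_projective (A_theta \<theta>) M"
    using M unfolding Obj_Vect by (blast intro: holomorphic_module_right_module)+
  have "f \<in> module_Hom (A_theta \<theta>) M (ob Q j)" "f' \<in> module_Hom (A_theta \<theta>) M (ob Q j')"
    using f f' by (simp_all add: Hom_HM)
  then obtain k u v where "k \<in> Obj (idx Q)" "u \<in> Hom (idx Q) j k" "v \<in> Hom (idx Q) j' k"
    "compose (carrier M) (mor Q j k u) f = compose (carrier M) (mor Q j' k v) f'"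
    using Q.fin_gen_projective_Hom_eq[where f = f and f' = f', OF rM fgp j j' _ _ eq] by blast
  then show ?thesis
    using j j' f f' by (intro germs.germ_eqI[OF germsI[OF Q M], where k = k and u = u and v = v])
      (simp_all add: Hom_Vect Cmp_Vect)
qed

lemma colim_map_inj:
  fixes P Q :: "('i, 'u, 'm) module_system"
  assumes P: "ind_object (Vect \<theta> \<tau>) P" and Q: "ind_object (Vect \<theta> \<tau>) Q"
  shows "inj_on (colim_map P Q) (ind_Hom (Vect \<theta> \<tau>) P Q)"
proof (rule inj_onI)
  fix \<phi> \<psi> assume \<phi>: "\<phi> \<in> ind_Hom (Vect \<theta> \<tau>) P Q" and \<psi>: "\<psi> \<in> ind_Hom (Vect \<theta> \<tau>) P Q"
    and eq: "colim_map P Q \<phi> = colim_map P Q \<psi>"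
  show "\<phi> = \<psi>"
  proof (rule ind_Hom_eqI[OF \<phi> \<psi>])
    fix i assume i: "i \<in> Obj (idx P)"
    obtain j f where j: "j \<in> Obj (idx Q)" "f \<in> Hom (HM \<theta> \<tau>) (ob P i) (ob Q j)"
      "\<phi> i = germ (Vect \<theta> \<tau>) Q (ob P i) j f"
      using ind_Hom_cases[OF P Q \<phi> i] unfolding Hom_Vect by blast
    obtain j' f' where j': "j' \<in> Obj (idx Q)" "f' \<in> Hom (HM \<theta> \<tau>) (ob P i) (ob Q j')"
      "\<psi> i = germ (Vect \<theta> \<tau>) Q (ob P i) j' f'"
      using ind_Hom_cases[OF P Q \<psi> i] unfolding Hom_Vect by blast
    have "elt Q j (f s) = elt Q j' (f' s)" if "s \<in> carrier (ob P i)" for s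
      using colim_map_elt[OF P Q \<phi> i that j] colim_map_elt[OF P Q \<psi> i that j'] eq by simp
    then show "\<phi> i = \<psi> i"
      unfolding j(3) j'(3) by (rule Vect_germ_eqI[OF ind_object_ob[OF P i] Q j(1) j'(1) j(2) j'(2)])
  qed
qed

text \<open>The restrictions of g to the stages of P are lifted independently, with no coherence
  between the choices. Compatibility is automatic: a germ out of a vector bundle is determined by
  the induced map into the colimit.\<close>

lemma colim_map_surj:
  fixes P Q :: "('i, 'u, 'm) module_system"
  assumes P: "ind_object (Vect \<theta> \<tau>) P" and Q: "ind_object (Vect \<theta> \<tau>) Q"
    and g: "g \<in> Hom (HM \<theta> \<tau>) (colim P) (colim Q)"
  obtains \<phi> where "\<phi> \<in> ind_Hom (Vect \<theta> \<tau>) P Q" "colim_map P Q \<phi> = g"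
proof -
  interpret P: holomorphic_system \<theta> \<tau> P
    using P by (rule holomorphic_system_Vect)
  interpret Q: holomorphic_system \<theta> \<tau> Q
    using Q by (rule holomorphic_system_Vect)
  have gm: "g \<in> module_Hom (A_theta \<theta>) (colim P) (colim Q)"
    and g_nabla: "\<And>x. x \<in> carrier (colim P) \<Longrightarrow> g (nabla (colim P) x) = nabla (colim Q) (g x)"
    using g by (simp_all add: Hom_HM)
  have "\<exists>j f. j \<in> Obj (idx Q) \<and> f \<in> Hom (HM \<theta> \<tau>) (ob P i) (ob Q j) \<and>
      (\<forall>s\<in>carrier (ob P i). g (elt P i s) = elt Q j (f s))" if i: "i \<in> Obj (idx P)" for i
  proof -
    have ob: "holomorphic_module \<theta> \<tau> (ob P i)" "fin_gen_projective (A_theta \<theta>) (ob P i)"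
      using ind_object_ob[OF P i] by (simp_all add: Obj_Vect)
    \<comment> \<open>The restriction of g along the canonical map of the vector bundle at stage i,
      to which the factorisation lemma applies.\<close>
    let ?h = "compose (carrier (ob P i)) g (P.coproj i)"
    have h: "?h \<in> module_Hom (A_theta \<theta>) (ob P i) (colim Q)"
      by (rule module_Hom_compose[OF P.right_module_ob[OF i] P.coproj_module_Hom[OF i] gm])
    have h_eq: "?h s = g (elt P i s)" if "s \<in> carrier (ob P i)" for s
      using that by (simp add: compose_eq P.coproj_eq)
    have h_nabla: "?h (nabla (ob P i) s) = nabla (colim Q) (?h s)" if "s \<in> carrier (ob P i)" for s
      using that i by (simp add: h_eq P.ob_closed g_nabla P.elt_closed flip: P.colim_nabla)
    obtain j f where "j \<in> Obj (idx Q)" "f \<in> Hom (HM \<theta> \<tau>) (ob P i) (ob Q j)"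
        "\<And>s. s \<in> carrier (ob P i) \<Longrightarrow> ?h s = elt Q j (f s)"
      using Q.fin_gen_projective_lift[OF ob h h_nabla] by blast
    then show ?thesis
      using h_eq by metis
  qed
  then obtain j f where j: "\<And>i. i \<in> Obj (idx P) \<Longrightarrow> j i \<in> Obj (idx Q)"
    and f: "\<And>i. i \<in> Obj (idx P) \<Longrightarrow> f i \<in> Hom (HM \<theta> \<tau>) (ob P i) (ob Q (j i))"
    and gf: "\<And>i s. \<lbrakk>i \<in> Obj (idx P); s \<in> carrier (ob P i)\<rbrakk> \<Longrightarrow> g (elt P i s) = elt Q (j i) (f i s)"
    by metis
  define \<phi> where "\<phi> = (\<lambda>i\<in>Obj (idx P). germ (Vect \<theta> \<tau>) Q (ob P i) (j i) (f i))"
  have \<phi>: "\<phi> \<in> ind_Hom (Vect \<theta> \<tau>) P Q"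
  proof (rule ind_HomI)
    show "\<phi> i \<in> colim_Hom (Vect \<theta> \<tau>) Q (ob P i)" if "i \<in> Obj (idx P)" for i
      using that j f by (simp add: \<phi>_def germs.germ_in_colim_Hom germsI Q ind_object_ob[OF P] Hom_Vect)
    fix i i' u assume i: "i \<in> Obj (idx P)" and i': "i' \<in> Obj (idx P)" and u: "u \<in> Hom (idx P) i i'"
    let ?f = "Cmp (Vect \<theta> \<tau>) (ob P i) (ob P i') (ob Q (j i')) (f i') (mor P i i' u)"
    have f': "f i' \<in> Hom (Vect \<theta> \<tau>) (ob P i') (ob Q (j i'))"
      using f[OF i'] by (simp add: Hom_Vect)
    have c: "?f \<in> Hom (Vect \<theta> \<tau>) (ob P i) (ob Q (j i'))"
      by (rule category_Cmp[OF category_Vect ind_object_ob[OF P i] ind_object_ob[OF P i']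
            ind_object_ob[OF Q j[OF i']] ind_object_mor[OF P i i' u] f'])
    \<comment> \<open>Both germs induce the restriction of g to stage i, since the transition map
      does not change classes in the colimit of P.\<close>
    have "germ (Vect \<theta> \<tau>) Q (ob P i) (j i') ?f = germ (Vect \<theta> \<tau>) Q (ob P i) (j i) (f i)"
    proof (rule Vect_germ_eqI[OF ind_object_ob[OF P i] Q j[OF i'] j[OF i] c[unfolded Hom_Vect] f[OF i]])
      fix s assume s: "s \<in> carrier (ob P i)"
      have "elt Q (j i') (f i' (mor P i i' u s)) = g (elt P i' (mor P i i' u s))"
        by (rule gf[OF i' P.mor_closed[OF i i' u s], symmetric])
      also have "\<dots> = elt Q (j i) (f i s)"
        by (simp add: P.cls_T[OF i i' u s] gf[OF i s])
      finally show "elt Q (j i') (?f s) = elt Q (j i) (f i s)"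
        using s by (simp add: Cmp_Vect compose_eq)
    qed
    then show "precomp (Vect \<theta> \<tau>) Q (ob P i) (ob P i') (mor P i i' u) (\<phi> i') = \<phi> i"
      using precomp_germ[OF Q ind_object_ob[OF P i] ind_object_ob[OF P i'] ind_object_mor[OF P i i' u] j[OF i'] f'] i i'
      by (simp add: \<phi>_def)
  qed (simp add: \<phi>_def)
  have "colim_map P Q \<phi> = g"
  proof (rule extensionalityI)
    fix x assume "x \<in> carrier (colim P)"
    then obtain i s where i: "i \<in> Obj (idx P)" "s \<in> carrier (ob P i)" "x = elt P i s"
      by (rule P.colim_cases)
    then show "colim_map P Q \<phi> x = g x"
      using colim_map_elt[OF P Q \<phi> i(1,2) j[OF i(1)] f[OF i(1)]] gf[OF i(1,2)] by (simp add: \<phi>_def)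
  qed (use Hom_HM_extensional[OF g] in \<open>simp_all add: colim_map_def\<close>)
  then show thesis
    using that \<phi> by blast
qed

text \<open>The target category is taken over the carrier type \<open>('i \<times> 'm) set\<close>,
  because elements of a colimit are classes of pairs of a stage and an element at that
  stage.\<close>

theorem proposition2p3p1:
  fixes \<theta> :: real and \<tau> :: complex
  assumes "\<theta> \<notin> \<rat>" and "Im \<tau> < 0"
  shows "fully_faithful_functor
    (Qcoh \<theta> \<tau> :: (('i, 'u, 'm) module_system, 'i \<Rightarrow> ('i \<times> ('m \<Rightarrow> 'm)) set) cat)
    (HM \<theta> \<tau> :: ((nct_elt, ('i \<times> 'm) set) conn_module, ('i \<times> 'm) set \<Rightarrow> ('i \<times> 'm) set) cat)
    colim colim_map"
proof -
  let ?Q = "Qcoh \<theta> \<tau> :: (('i, 'u, 'm) module_system, 'i \<Rightarrow> ('i \<times> ('m \<Rightarrow> 'm)) set) cat"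
  have Obj: "P \<in> Obj ?Q \<longleftrightarrow> ind_object (Vect \<theta> \<tau>) P" for P
    by (simp add: Qcoh_def Ind_def)
  have Hom: "Hom ?Q = ind_Hom (Vect \<theta> \<tau>)" and Idn: "Idn ?Q = ind_Idn (Vect \<theta> \<tau>)"
    and Cmp: "Cmp ?Q = ind_Cmp (Vect \<theta> \<tau>)"
    by (simp_all add: Qcoh_def Ind_def)
  have "category ?Q"
    unfolding Qcoh_def by (rule category_Ind[OF category_Vect])
  moreover have "colim P \<in> Obj (HM \<theta> \<tau>)" if "ind_object (Vect \<theta> \<tau>) P" for P :: "('i, 'u, 'm) module_system"
    unfolding Obj_HM by (rule holomorphic_system.holomorphic_module_colim[OF holomorphic_system_Vect[OF that]])
  ultimately have "is_functor ?Q (HM \<theta> \<tau>) colim colim_map"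
    unfolding is_functor_def Obj Hom Idn Cmp Ball_def
    by (simp add: category_HM colim_map_in_Hom colim_map_Idn colim_map_Cmp Idn_HM Cmp_HM)
  moreover have "bij_betw (colim_map P Q) (ind_Hom (Vect \<theta> \<tau>) P Q) (Hom (HM \<theta> \<tau>) (colim P) (colim Q))"
    if "ind_object (Vect \<theta> \<tau>) P" "ind_object (Vect \<theta> \<tau>) Q" for P Q :: "('i, 'u, 'm) module_system"
    unfolding bij_betw_def
    using colim_map_inj[OF that] colim_map_in_Hom[OF that] colim_map_surj[OF that] by blast
  ultimately show ?thesis
    unfolding fully_faithful_functor_def Obj Hom Ball_def by simp
qed

end
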